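(* Let $H$ be a cocommutative weak Hopf algebra in $\mathcal{C}$, $(A,\varphi_A)$ a weak left $H$-module algebra and $\alpha,\beta\in Reg^{+}_{\varphi_A}(H^2,A)$ both satisfying the twisted condition and the 2-cocycle condition. The weak crossed products $A\otimes_\alpha H$ and $A\otimes_\beta H$ are equivalent if and only if there exist morphisms $\Gamma,\Gamma':A\otimes H\to A\otimes H$ of left $A$-modules and right $H$-comodules (for the action $\mu_A\otimes H$ and coaction $A\otimes\delta_H$) which are multiplicative, i.e. $\Gamma\circ\mu_{A\otimes_\alpha H}=\mu_{A\otimes_\beta H}\circ(\Gamma\otimes\Gamma)$ and $\Gamma'\circ\mu_{A\otimes_\beta H}=\mu_{A\otimes_\alpha H}\circ(\Gamma'\otimes\Gamma')$, which preserve the preunit $\nu=\nabla_{A\otimes H}\circ(\eta_A\otimes\eta_H)$, i.e. $\Gamma\circ\nu=\nu=\Gamma'\circ\nu$, and which satisfy (e1) $\Gamma\circ\Gamma'=\Gamma'\circ\Gamma=\nabla_{A\otimes H}$; (e2) $\Gamma\circ\Gamma'\circ\Gamma=\Gamma$; (e3) $\Gamma'\circ\Gamma\circ\Gamma'=\Gamma'$.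
   Context: Throughout, $\mathcal{C}$ is a strict symmetric monoidal category with tensor product $\otimes$, unit object $K$, symmetry $c$, and equalizers (hence every idempotent $q:Y\to Y$ splits: $q=i\circ p$ with $p\circ i=id$). For an object $P$ and a morphism $f$, $P\otimes f$ means $id_P\otimes f$ (likewise $f\otimes P$). Algebras $(A,\eta_A,\mu_A)$ are unital associative, coalgebras $(D,\varepsilon_D,\delta_D)$ counital coassociative, all in $\mathcal{C}$; $D$ is cocommutative if $c_{D,D}\circ\delta_D=\delta_D$. For coalgebras $D,E$: $\varepsilon_{D\otimes E}=\varepsilon_D\otimes\varepsilon_E$, $\delta_{D\otimes E}=(D\otimes c_{D,E}\otimes E)\circ(\delta_D\otimes\delta_E)$; $H^n$ is the $n$-fold tensor power with the resulting coalgebra structure. For morphisms $f,g:B\to A$ from a coalgebra to an algebra, $f\wedge g=\mu_A\circ(f\otimes g)\circ\delta_B$. A weak Hopf algebra $H$ is an algebra and coalgebra in $\mathcal{C}$ with: (a1) $\delta_H\circ\mu_H=(\mu_H\otimes\mu_H)\circ\delta_{H\otimes H}$; (a2) $\varepsilon_H\circ\mu_H\circ(\mu_H\otimes H)=(\varepsilon_H\otimes\varepsilon_H)\circ(\mu_H\otimes\mu_H)\circ(H\otimes\delta_H\otimes H)=(\varepsilon_H\otimes\varepsilon_H)\circ(\mu_H\otimes\mu_H)\circ(H\otimes(c_{H,H}\circ\delta_H)\otimes H)$; (a3) $(\delta_H\otimes H)\circ\delta_H\circ\eta_H=(H\otimes\mu_H\otimes H)\circ(\delta_H\otimes\delta_H)\circ(\eta_H\otimes\eta_H)=(H\otimes(\mu_H\circ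 c_{H,H})\otimes H)\circ(\delta_H\otimes\delta_H)\circ(\eta_H\otimes\eta_H)$; (a4) there is an antipode $\lambda_H:H\to H$ with $id_H\wedge\lambda_H=\Pi_H^L$, $\lambda_H\wedge id_H=\Pi_H^R$, $\lambda_H\wedge id_H\wedge\lambda_H=\lambda_H$, where $\Pi_H^L=((\varepsilon_H\circ\mu_H)\otimes H)\circ(H\otimes c_{H,H})\circ((\delta_H\circ\eta_H)\otimes H)$ and $\Pi_H^R=(H\otimes(\varepsilon_H\circ\mu_H))\circ(c_{H,H}\otimes H)\circ(H\otimes(\delta_H\circ\eta_H))$. A weak left $H$-module algebra is an algebra $A$ with $\varphi_A:H\otimes A\to A$ such that (b1) $\varphi_A\circ(\eta_H\otimes A)=id_A$; (b2) $\varphi_A\circ(H\otimes\mu_A)=\mu_A\circ(\varphi_A\otimes\varphi_A)\circ(H\otimes c_{H,A}\otimes A)\circ(\delta_H\otimes A\otimes A)$; (b3) $\varphi_A\circ(\mu_H\otimes\eta_A)=\varphi_A\circ(H\otimes(\varphi_A\circ(H\otimes\eta_A)))$; (b6) $\varphi_A\circ(\Pi_H^L\otimes\eta_A)=\varphi_A\circ(H\otimes\eta_A)$ (equivalently (b4) $\varphi_A\circ(\Pi_H^L\otimes A)=\mu_A\circ((\varphi_A\circ(H\otimes\eta_A))\otimes A)$). $u_1=\varphi_A\circ(H\otimes\eta_A)$, $u_2=\varphi_A\circ(\mu_H\otimes\eta_A)$. $Reg_{\varphi_A}(H^2,A)$ is the set of $\sigma:H^2\to A$ for which there is $\sigma^{-1}:H^2\to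 A$ with $\sigma\wedge\sigma^{-1}=\sigma^{-1}\wedge\sigma=u_2$, $\sigma\wedge\sigma^{-1}\wedge\sigma=\sigma$, $\sigma^{-1}\wedge\sigma\wedge\sigma^{-1}=\sigma^{-1}$. $Reg^+_{\varphi_A}(H^2,A)=\{\sigma\in Reg_{\varphi_A}(H^2,A):\sigma\circ(\eta_H\otimes H)=\sigma\circ(H\otimes\eta_H)=u_1\}$. For $\sigma:H^2\to A$: $\partial_{2,0}(\sigma)=\varphi_A\circ(H\otimes\sigma)$, $\partial_{2,1}(\sigma)=\sigma\circ(\mu_H\otimes H)$, $\partial_{2,2}(\sigma)=\sigma\circ(H\otimes\mu_H)$, $\partial_{2,3}(\sigma)=\sigma\circ(H\otimes(\mu_H\circ(H\otimes\Pi_H^L)))$. $\psi_H^A=(\varphi_A\otimes H)\circ(H\otimes c_{H,A})\circ(\delta_H\otimes A)$, $\sigma^A_{H,\alpha}=(\alpha\otimes\mu_H)\circ\delta_{H^2}$. Twisted condition for $\alpha$: $\mu_A\circ((\varphi_A\circ(H\otimes\varphi_A))\otimes A)\circ(H\otimes H\otimes c_{A,A})\circ(((H\otimes H\otimes\alpha)\circ\delta_{H^2})\otimes A)=\mu_A\circ(A\otimes\varphi_A)\circ(\sigma^A_{H,\alpha}\otimes A)$. 2-cocycle condition for $\alpha$: $\partial_{2,3}(\alpha)\wedge\partial_{2,1}(\alpha)=\partial_{2,0}(\alpha)\wedge\partial_{2,2}(\alpha)$. $\nabla_{A\otimes H}=(\mu_A\otimes H)\circ(A\otimes\psi_H^A)\circ(A\otimes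 H\otimes\eta_A)$ is an idempotent, split as $i_{A\otimes H}\circ p_{A\otimes H}$ through $A\times H$. The weak crossed product $A\otimes_\alpha H$ is $A\otimes H$ with the (associative) product $\mu_{A\otimes_\alpha H}=(\mu_A\otimes H)\circ(\mu_A\otimes\sigma^A_{H,\alpha})\circ(A\otimes\psi_H^A\otimes H)$ and preunit $\nu=\nabla_{A\otimes H}\circ(\eta_A\otimes\eta_H)$. Its associated algebra $A\times_\alpha H$ is $A\times H$ with unit $p_{A\otimes H}\circ\nu$ and product $p_{A\otimes H}\circ\mu_{A\otimes_\alpha H}\circ(i_{A\otimes H}\otimes i_{A\otimes H})$; it carries the left $A$-action $p_{A\otimes H}\circ(\mu_A\otimes H)\circ(A\otimes i_{A\otimes H})$ and the right $H$-coaction $(p_{A\otimes H}\otimes H)\circ(A\otimes\delta_H)\circ i_{A\otimes H}$. $A\otimes_\alpha H$ and $A\otimes_\beta H$ are equivalent if there is an isomorphism $A\times_\alpha H\to A\times_\beta H$ which is a morphism of algebras, of left $A$-modules and of right $H$-comodules. *)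

theory Defs
  imports Main
begin

text \<open>
  Morphisms are the elements of \<open>Arr C\<close>; the operations of the record are total functions of
  which only the values on objects, arrows and composable pairs are constrained.
  \<open>g \<cdot> f\<close> is composition (first \<open>f\<close>, then \<open>g\<close>), \<open>\<langle>X\<rangle>\<close> is the identity of \<open>X\<close>, so that
  the customary \<open>P \<otimes> f\<close> for an object \<open>P\<close> is written \<open>\<langle>P\<rangle> \<otimes> f\<close>; the tensor product of objects
  is \<open>X \<odot> Y\<close>, the unit object \<open>K\<close> is \<open>Unit C\<close>, and \<open>Sym C X Y\<close> is the symmetry.
\<close>

record ('o, 'm) smcat =
  Obj :: "'o set"
  Arr :: "'m set"
  Dom :: "'m \<Rightarrow> 'o"
  Cod :: "'m \<Rightarrow> 'o"
  Ident :: "'o \<Rightarrow> 'm" ("\<langle>_\<rangle>\<index>")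
  Comp :: "'m \<Rightarrow> 'm \<Rightarrow> 'm" (infixr "\<cdot>\<index>" 60)
  TensorO :: "'o \<Rightarrow> 'o \<Rightarrow> 'o" (infixr "\<odot>\<index>" 70)
  TensorM :: "'m \<Rightarrow> 'm \<Rightarrow> 'm" (infixr "\<otimes>\<index>" 70)
  Unit :: "'o"
  Sym :: "'o \<Rightarrow> 'o \<Rightarrow> 'm" ("\<c>\<index>")

definition hom :: "('o, 'm) smcat \<Rightarrow> 'o \<Rightarrow> 'o \<Rightarrow> 'm set" where
  "hom C X Y = {f \<in> Arr C. Dom C f = X \<and> Cod C f = Y}"

definition is_equalizer :: "('o, 'm) smcat \<Rightarrow> 'o \<Rightarrow> 'o \<Rightarrow> 'm \<Rightarrow> 'm \<Rightarrow> 'o \<Rightarrow> 'm \<Rightarrow> bool" where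
  "is_equalizer C X Y f g E e \<longleftrightarrow>
     E \<in> Obj C \<and> e \<in> hom C E X \<and> f \<cdot>\<^bsub>C\<^esub> e = g \<cdot>\<^bsub>C\<^esub> e \<and>
     (\<forall>T\<in>Obj C. \<forall>h\<in>hom C T X. f \<cdot>\<^bsub>C\<^esub> h = g \<cdot>\<^bsub>C\<^esub> h \<longrightarrow> (\<exists>!k. k \<in> hom C T E \<and> e \<cdot>\<^bsub>C\<^esub> k = h))"

locale category =
  fixes C :: "('o, 'm) smcat" (structure)
  assumes Dom_Obj: "f \<in> Arr C \<Longrightarrow> Dom C f \<in> Obj C"
    and Cod_Obj: "f \<in> Arr C \<Longrightarrow> Cod C f \<in> Obj C"
    and Ident_hom: "X \<in> Obj C \<Longrightarrow> \<langle>X\<rangle> \<in> hom C X X"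
    and Comp_hom: "\<lbrakk>f \<in> hom C X Y; g \<in> hom C Y Z\<rbrakk> \<Longrightarrow> g \<cdot> f \<in> hom C X Z"
    and Comp_assoc: "\<lbrakk>f \<in> hom C X Y; g \<in> hom C Y Z; h \<in> hom C Z W\<rbrakk>
                      \<Longrightarrow> (h \<cdot> g) \<cdot> f = h \<cdot> (g \<cdot> f)"
    and Comp_Ident_right: "f \<in> hom C X Y \<Longrightarrow> f \<cdot> \<langle>X\<rangle> = f"
    and Comp_Ident_left: "f \<in> hom C X Y \<Longrightarrow> \<langle>Y\<rangle> \<cdot> f = f"

locale strict_monoidal_category = category +
  assumes Unit_Obj: "Unit C \<in> Obj C"
    and TensorO_Obj: "\<lbrakk>X \<in> Obj C; Y \<in> Obj C\<rbrakk> \<Longrightarrow> X \<odot> Y \<in> Obj C"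
    and TensorM_hom: "\<lbrakk>f \<in> hom C X Y; g \<in> hom C Z W\<rbrakk> \<Longrightarrow> f \<otimes> g \<in> hom C (X \<odot> Z) (Y \<odot> W)"
    and TensorM_Ident: "\<lbrakk>X \<in> Obj C; Y \<in> Obj C\<rbrakk> \<Longrightarrow> \<langle>X\<rangle> \<otimes> \<langle>Y\<rangle> = \<langle>X \<odot> Y\<rangle>"
    and interchange: "\<lbrakk>f \<in> hom C X Y; f' \<in> hom C Y Z; g \<in> hom C U V; g' \<in> hom C V W\<rbrakk>
                      \<Longrightarrow> (f' \<cdot> f) \<otimes> (g' \<cdot> g) = (f' \<otimes> g') \<cdot> (f \<otimes> g)"
    and TensorO_assoc: "\<lbrakk>X \<in> Obj C; Y \<in> Obj C; Z \<in> Obj C\<rbrakk>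
                      \<Longrightarrow> (X \<odot> Y) \<odot> Z = X \<odot> (Y \<odot> Z)"
    and TensorM_assoc: "\<lbrakk>f \<in> Arr C; g \<in> Arr C; h \<in> Arr C\<rbrakk>
                      \<Longrightarrow> (f \<otimes> g) \<otimes> h = f \<otimes> (g \<otimes> h)"
    and TensorO_Unit: "X \<in> Obj C \<Longrightarrow> Unit C \<odot> X = X" "X \<in> Obj C \<Longrightarrow> X \<odot> Unit C = X"
    and TensorM_Unit: "f \<in> Arr C \<Longrightarrow> \<langle>Unit C\<rangle> \<otimes> f = f" "f \<in> Arr C \<Longrightarrow> f \<otimes> \<langle>Unit C\<rangle> = f"

locale strict_symmetric_monoidal_category = strict_monoidal_category +
  assumes Sym_hom: "\<lbrakk>X \<in> Obj C; Y \<in> Obj C\<rbrakk> \<Longrightarrow> \<c> X Y \<in> hom C (X \<odot> Y) (Y \<odot> X)"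
    and Sym_natural: "\<lbrakk>f \<in> hom C X X'; g \<in> hom C Y Y'\<rbrakk>
                      \<Longrightarrow> \<c> X' Y' \<cdot> (f \<otimes> g) = (g \<otimes> f) \<cdot> \<c> X Y"
    and Sym_inverse: "\<lbrakk>X \<in> Obj C; Y \<in> Obj C\<rbrakk> \<Longrightarrow> \<c> Y X \<cdot> \<c> X Y = \<langle>X \<odot> Y\<rangle>"
    and hexagon: "\<lbrakk>X \<in> Obj C; Y \<in> Obj C; Z \<in> Obj C\<rbrakk>
                      \<Longrightarrow> \<c> X (Y \<odot> Z) = (\<langle>Y\<rangle> \<otimes> \<c> X Z) \<cdot> (\<c> X Y \<otimes> \<langle>Z\<rangle>)"

locale strict_symmetric_monoidal_category_with_equalizers = strict_symmetric_monoidal_category +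
  assumes equalizers: "\<lbrakk>X \<in> Obj C; Y \<in> Obj C; f \<in> hom C X Y; g \<in> hom C X Y\<rbrakk>
                      \<Longrightarrow> \<exists>E e. is_equalizer C X Y f g E e"


record ('o, 'm) alg =
  ob :: 'o
  unit_mor :: 'm ("\<eta>\<index>")
  mult_mor :: 'm ("\<mu>\<index>")

record ('o, 'm) alg_coalg = "('o, 'm) alg" +
  counit_mor :: 'm ("\<epsilon>\<index>")
  comult_mor :: 'm ("\<delta>\<index>")

context
  fixes C :: "('o, 'm) smcat" (structure)
begin

definition algebra :: "('o, 'm, 'z) alg_scheme \<Rightarrow> bool" where
  "algebra A \<longleftrightarrow>
     ob A \<in> Obj C \<and>
     \<eta>\<^bsub>A\<^esub> \<in> hom C (Unit C) (ob A) \<and>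
     \<mu>\<^bsub>A\<^esub> \<in> hom C (ob A \<odot> ob A) (ob A) \<and>
     \<mu>\<^bsub>A\<^esub> \<cdot> (\<langle>ob A\<rangle> \<otimes> \<eta>\<^bsub>A\<^esub>) = \<langle>ob A\<rangle> \<and>
     \<mu>\<^bsub>A\<^esub> \<cdot> (\<eta>\<^bsub>A\<^esub> \<otimes> \<langle>ob A\<rangle>) = \<langle>ob A\<rangle> \<and>
     \<mu>\<^bsub>A\<^esub> \<cdot> (\<mu>\<^bsub>A\<^esub> \<otimes> \<langle>ob A\<rangle>) = \<mu>\<^bsub>A\<^esub> \<cdot> (\<langle>ob A\<rangle> \<otimes> \<mu>\<^bsub>A\<^esub>)"

definition coalgebra :: "('o, 'm, 'z) alg_coalg_scheme \<Rightarrow> bool" where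
  "coalgebra D \<longleftrightarrow>
     ob D \<in> Obj C \<and>
     \<epsilon>\<^bsub>D\<^esub> \<in> hom C (ob D) (Unit C) \<and>
     \<delta>\<^bsub>D\<^esub> \<in> hom C (ob D) (ob D \<odot> ob D) \<and>
     (\<langle>ob D\<rangle> \<otimes> \<epsilon>\<^bsub>D\<^esub>) \<cdot> \<delta>\<^bsub>D\<^esub> = \<langle>ob D\<rangle> \<and>
     (\<epsilon>\<^bsub>D\<^esub> \<otimes> \<langle>ob D\<rangle>) \<cdot> \<delta>\<^bsub>D\<^esub> = \<langle>ob D\<rangle> \<and>
     (\<delta>\<^bsub>D\<^esub> \<otimes> \<langle>ob D\<rangle>) \<cdot> \<delta>\<^bsub>D\<^esub> = (\<langle>ob D\<rangle> \<otimes> \<delta>\<^bsub>D\<^esub>) \<cdot> \<delta>\<^bsub>D\<^esub>"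

definition cocommutative :: "('o, 'm, 'z) alg_coalg_scheme \<Rightarrow> bool" where
  "cocommutative D \<longleftrightarrow> \<c> (ob D) (ob D) \<cdot> \<delta>\<^bsub>D\<^esub> = \<delta>\<^bsub>D\<^esub>"

text \<open>Comultiplication of the tensor product of coalgebras with objects \<open>D\<close>, \<open>E\<close> and
  comultiplications \<open>d\<close>, \<open>e\<close>.\<close>

definition tensor_comult :: "'o \<Rightarrow> 'm \<Rightarrow> 'o \<Rightarrow> 'm \<Rightarrow> 'm" where
  "tensor_comult D d E e = (\<langle>D\<rangle> \<otimes> \<c> D E \<otimes> \<langle>E\<rangle>) \<cdot> (d \<otimes> e)"

definition comult2 :: "('o, 'm, 'z) alg_coalg_scheme \<Rightarrow> 'm" where
  "comult2 H = tensor_comult (ob H) \<delta>\<^bsub>H\<^esub> (ob H) \<delta>\<^bsub>H\<^esub>"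

definition comult3 :: "('o, 'm, 'z) alg_coalg_scheme \<Rightarrow> 'm" where
  "comult3 H = tensor_comult (ob H \<odot> ob H) (comult2 H) (ob H) \<delta>\<^bsub>H\<^esub>"

text \<open>Convolution \<open>f \<and> g\<close> of morphisms from a coalgebra with comultiplication \<open>d\<close> to an algebra
  with product \<open>m\<close>.\<close>

definition conv :: "'m \<Rightarrow> 'm \<Rightarrow> 'm \<Rightarrow> 'm \<Rightarrow> 'm" where
  "conv d m f g = m \<cdot> (f \<otimes> g) \<cdot> d"

definition PiL :: "('o, 'm, 'z) alg_coalg_scheme \<Rightarrow> 'm" where
  "PiL H = ((\<epsilon>\<^bsub>H\<^esub> \<cdot> \<mu>\<^bsub>H\<^esub>) \<otimes> \<langle>ob H\<rangle>) \<cdot> (\<langle>ob H\<rangle> \<otimes> \<c> (ob H) (ob H)) \<cdot> ((\<delta>\<^bsub>H\<^esub> \<cdot> \<eta>\<^bsub>H\<^esub>) \<otimes> \<langle>ob H\<rangle>)"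

definition PiR :: "('o, 'm, 'z) alg_coalg_scheme \<Rightarrow> 'm" where
  "PiR H = (\<langle>ob H\<rangle> \<otimes> (\<epsilon>\<^bsub>H\<^esub> \<cdot> \<mu>\<^bsub>H\<^esub>)) \<cdot> (\<c> (ob H) (ob H) \<otimes> \<langle>ob H\<rangle>) \<cdot> (\<langle>ob H\<rangle> \<otimes> (\<delta>\<^bsub>H\<^esub> \<cdot> \<eta>\<^bsub>H\<^esub>))"

definition antipode :: "('o, 'm, 'z) alg_coalg_scheme \<Rightarrow> 'm \<Rightarrow> bool" where
  "antipode H l \<longleftrightarrow>
     l \<in> hom C (ob H) (ob H) \<and>
     conv \<delta>\<^bsub>H\<^esub> \<mu>\<^bsub>H\<^esub> \<langle>ob H\<rangle> l = PiL H \<and>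
     conv \<delta>\<^bsub>H\<^esub> \<mu>\<^bsub>H\<^esub> l \<langle>ob H\<rangle> = PiR H \<and>
     conv \<delta>\<^bsub>H\<^esub> \<mu>\<^bsub>H\<^esub> (conv \<delta>\<^bsub>H\<^esub> \<mu>\<^bsub>H\<^esub> l \<langle>ob H\<rangle>) l = l"

definition weak_Hopf_algebra :: "('o, 'm, 'z) alg_coalg_scheme \<Rightarrow> bool" where
  "weak_Hopf_algebra H \<longleftrightarrow>
     algebra H \<and> coalgebra H \<and>
     \<delta>\<^bsub>H\<^esub> \<cdot> \<mu>\<^bsub>H\<^esub> = (\<mu>\<^bsub>H\<^esub> \<otimes> \<mu>\<^bsub>H\<^esub>) \<cdot> comult2 H \<and>
     \<epsilon>\<^bsub>H\<^esub> \<cdot> \<mu>\<^bsub>H\<^esub> \<cdot> (\<mu>\<^bsub>H\<^esub> \<otimes> \<langle>ob H\<rangle>) =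
       (\<epsilon>\<^bsub>H\<^esub> \<otimes> \<epsilon>\<^bsub>H\<^esub>) \<cdot> (\<mu>\<^bsub>H\<^esub> \<otimes> \<mu>\<^bsub>H\<^esub>) \<cdot> (\<langle>ob H\<rangle> \<otimes> \<delta>\<^bsub>H\<^esub> \<otimes> \<langle>ob H\<rangle>) \<and>
     \<epsilon>\<^bsub>H\<^esub> \<cdot> \<mu>\<^bsub>H\<^esub> \<cdot> (\<mu>\<^bsub>H\<^esub> \<otimes> \<langle>ob H\<rangle>) =
       (\<epsilon>\<^bsub>H\<^esub> \<otimes> \<epsilon>\<^bsub>H\<^esub>) \<cdot> (\<mu>\<^bsub>H\<^esub> \<otimes> \<mu>\<^bsub>H\<^esub>) \<cdot> (\<langle>ob H\<rangle> \<otimes> (\<c> (ob H) (ob H) \<cdot> \<delta>\<^bsub>H\<^esub>) \<otimes> \<langle>ob H\<rangle>) \<and>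
     (\<delta>\<^bsub>H\<^esub> \<otimes> \<langle>ob H\<rangle>) \<cdot> \<delta>\<^bsub>H\<^esub> \<cdot> \<eta>\<^bsub>H\<^esub> =
       (\<langle>ob H\<rangle> \<otimes> \<mu>\<^bsub>H\<^esub> \<otimes> \<langle>ob H\<rangle>) \<cdot> (\<delta>\<^bsub>H\<^esub> \<otimes> \<delta>\<^bsub>H\<^esub>) \<cdot> (\<eta>\<^bsub>H\<^esub> \<otimes> \<eta>\<^bsub>H\<^esub>) \<and>
     (\<delta>\<^bsub>H\<^esub> \<otimes> \<langle>ob H\<rangle>) \<cdot> \<delta>\<^bsub>H\<^esub> \<cdot> \<eta>\<^bsub>H\<^esub> =
       (\<langle>ob H\<rangle> \<otimes> (\<mu>\<^bsub>H\<^esub> \<cdot> \<c> (ob H) (ob H)) \<otimes> \<langle>ob H\<rangle>) \<cdot> (\<delta>\<^bsub>H\<^esub> \<otimes> \<delta>\<^bsub>H\<^esub>) \<cdot> (\<eta>\<^bsub>H\<^esub> \<otimes> \<eta>\<^bsub>H\<^esub>) \<and>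
     (\<exists>l. antipode H l)"

definition u1 :: "('o, 'm, 'z) alg_coalg_scheme \<Rightarrow> ('o, 'm, 'y) alg_scheme \<Rightarrow> 'm \<Rightarrow> 'm" where
  "u1 H A \<phi> = \<phi> \<cdot> (\<langle>ob H\<rangle> \<otimes> \<eta>\<^bsub>A\<^esub>)"

definition u2 :: "('o, 'm, 'z) alg_coalg_scheme \<Rightarrow> ('o, 'm, 'y) alg_scheme \<Rightarrow> 'm \<Rightarrow> 'm" where
  "u2 H A \<phi> = \<phi> \<cdot> (\<mu>\<^bsub>H\<^esub> \<otimes> \<eta>\<^bsub>A\<^esub>)"

definition weak_left_module_algebra ::
    "('o, 'm, 'z) alg_coalg_scheme \<Rightarrow> ('o, 'm, 'y) alg_scheme \<Rightarrow> 'm \<Rightarrow> bool" where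
  "weak_left_module_algebra H A \<phi> \<longleftrightarrow>
     algebra A \<and>
     \<phi> \<in> hom C (ob H \<odot> ob A) (ob A) \<and>
     \<phi> \<cdot> (\<eta>\<^bsub>H\<^esub> \<otimes> \<langle>ob A\<rangle>) = \<langle>ob A\<rangle> \<and>
     \<phi> \<cdot> (\<langle>ob H\<rangle> \<otimes> \<mu>\<^bsub>A\<^esub>) =
       \<mu>\<^bsub>A\<^esub> \<cdot> (\<phi> \<otimes> \<phi>) \<cdot> (\<langle>ob H\<rangle> \<otimes> \<c> (ob H) (ob A) \<otimes> \<langle>ob A\<rangle>) \<cdot> (\<delta>\<^bsub>H\<^esub> \<otimes> \<langle>ob A\<rangle> \<otimes> \<langle>ob A\<rangle>) \<and>
     \<phi> \<cdot> (\<mu>\<^bsub>H\<^esub> \<otimes> \<eta>\<^bsub>A\<^esub>) = \<phi> \<cdot> (\<langle>ob H\<rangle> \<otimes> (\<phi> \<cdot> (\<langle>ob H\<rangle> \<otimes> \<eta>\<^bsub>A\<^esub>))) \<and>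
     \<phi> \<cdot> (PiL H \<otimes> \<eta>\<^bsub>A\<^esub>) = \<phi> \<cdot> (\<langle>ob H\<rangle> \<otimes> \<eta>\<^bsub>A\<^esub>)"

definition Reg :: "('o, 'm, 'z) alg_coalg_scheme \<Rightarrow> ('o, 'm, 'y) alg_scheme \<Rightarrow> 'm \<Rightarrow> 'm set" where
  "Reg H A \<phi> = {\<sigma> \<in> hom C (ob H \<odot> ob H) (ob A). \<exists>\<tau> \<in> hom C (ob H \<odot> ob H) (ob A).
     conv (comult2 H) \<mu>\<^bsub>A\<^esub> \<sigma> \<tau> = u2 H A \<phi> \<and>
     conv (comult2 H) \<mu>\<^bsub>A\<^esub> \<tau> \<sigma> = u2 H A \<phi> \<and>
     conv (comult2 H) \<mu>\<^bsub>A\<^esub> (conv (comult2 H) \<mu>\<^bsub>A\<^esub> \<sigma> \<tau>) \<sigma> = \<sigma> \<and>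
     conv (comult2 H) \<mu>\<^bsub>A\<^esub> (conv (comult2 H) \<mu>\<^bsub>A\<^esub> \<tau> \<sigma>) \<tau> = \<tau>}"

definition Reg_plus :: "('o, 'm, 'z) alg_coalg_scheme \<Rightarrow> ('o, 'm, 'y) alg_scheme \<Rightarrow> 'm \<Rightarrow> 'm set" where
  "Reg_plus H A \<phi> = {\<sigma> \<in> Reg H A \<phi>.
     \<sigma> \<cdot> (\<eta>\<^bsub>H\<^esub> \<otimes> \<langle>ob H\<rangle>) = u1 H A \<phi> \<and> \<sigma> \<cdot> (\<langle>ob H\<rangle> \<otimes> \<eta>\<^bsub>H\<^esub>) = u1 H A \<phi>}"

text \<open>\<open>d2k\<close> is the map customarily denoted \<open>\<partial>\<close> with indices \<open>2, k\<close>.\<close>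

definition d20 :: "('o, 'm, 'z) alg_coalg_scheme \<Rightarrow> 'm \<Rightarrow> 'm \<Rightarrow> 'm" where
  "d20 H \<phi> \<sigma> = \<phi> \<cdot> (\<langle>ob H\<rangle> \<otimes> \<sigma>)"

definition d21 :: "('o, 'm, 'z) alg_coalg_scheme \<Rightarrow> 'm \<Rightarrow> 'm" where
  "d21 H \<sigma> = \<sigma> \<cdot> (\<mu>\<^bsub>H\<^esub> \<otimes> \<langle>ob H\<rangle>)"

definition d22 :: "('o, 'm, 'z) alg_coalg_scheme \<Rightarrow> 'm \<Rightarrow> 'm" where
  "d22 H \<sigma> = \<sigma> \<cdot> (\<langle>ob H\<rangle> \<otimes> \<mu>\<^bsub>H\<^esub>)"

definition d23 :: "('o, 'm, 'z) alg_coalg_scheme \<Rightarrow> 'm \<Rightarrow> 'm" where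
  "d23 H \<sigma> = \<sigma> \<cdot> (\<langle>ob H\<rangle> \<otimes> (\<mu>\<^bsub>H\<^esub> \<cdot> (\<langle>ob H\<rangle> \<otimes> PiL H)))"

definition psi :: "('o, 'm, 'z) alg_coalg_scheme \<Rightarrow> ('o, 'm, 'y) alg_scheme \<Rightarrow> 'm \<Rightarrow> 'm" where
  "psi H A \<phi> = (\<phi> \<otimes> \<langle>ob H\<rangle>) \<cdot> (\<langle>ob H\<rangle> \<otimes> \<c> (ob H) (ob A)) \<cdot> (\<delta>\<^bsub>H\<^esub> \<otimes> \<langle>ob A\<rangle>)"

definition sigma_of :: "('o, 'm, 'z) alg_coalg_scheme \<Rightarrow> 'm \<Rightarrow> 'm" where
  "sigma_of H \<alpha> = (\<alpha> \<otimes> \<mu>\<^bsub>H\<^esub>) \<cdot> comult2 H"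

definition twisted :: "('o, 'm, 'z) alg_coalg_scheme \<Rightarrow> ('o, 'm, 'y) alg_scheme \<Rightarrow> 'm \<Rightarrow> 'm \<Rightarrow> bool" where
  "twisted H A \<phi> \<alpha> \<longleftrightarrow>
     \<mu>\<^bsub>A\<^esub> \<cdot> ((\<phi> \<cdot> (\<langle>ob H\<rangle> \<otimes> \<phi>)) \<otimes> \<langle>ob A\<rangle>) \<cdot> (\<langle>ob H\<rangle> \<otimes> \<langle>ob H\<rangle> \<otimes> \<c> (ob A) (ob A))
       \<cdot> (((\<langle>ob H\<rangle> \<otimes> \<langle>ob H\<rangle> \<otimes> \<alpha>) \<cdot> comult2 H) \<otimes> \<langle>ob A\<rangle>) =
     \<mu>\<^bsub>A\<^esub> \<cdot> (\<langle>ob A\<rangle> \<otimes> \<phi>) \<cdot> (sigma_of H \<alpha> \<otimes> \<langle>ob A\<rangle>)"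

definition two_cocycle :: "('o, 'm, 'z) alg_coalg_scheme \<Rightarrow> ('o, 'm, 'y) alg_scheme \<Rightarrow> 'm \<Rightarrow> 'm \<Rightarrow> bool" where
  "two_cocycle H A \<phi> \<alpha> \<longleftrightarrow>
     conv (comult3 H) \<mu>\<^bsub>A\<^esub> (d23 H \<alpha>) (d21 H \<alpha>) = conv (comult3 H) \<mu>\<^bsub>A\<^esub> (d20 H \<phi> \<alpha>) (d22 H \<alpha>)"

definition nabla :: "('o, 'm, 'z) alg_coalg_scheme \<Rightarrow> ('o, 'm, 'y) alg_scheme \<Rightarrow> 'm \<Rightarrow> 'm" where
  "nabla H A \<phi> = (\<mu>\<^bsub>A\<^esub> \<otimes> \<langle>ob H\<rangle>) \<cdot> (\<langle>ob A\<rangle> \<otimes> psi H A \<phi>) \<cdot> (\<langle>ob A\<rangle> \<otimes> \<langle>ob H\<rangle> \<otimes> \<eta>\<^bsub>A\<^esub>)"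

definition preunit :: "('o, 'm, 'z) alg_coalg_scheme \<Rightarrow> ('o, 'm, 'y) alg_scheme \<Rightarrow> 'm \<Rightarrow> 'm" where
  "preunit H A \<phi> = nabla H A \<phi> \<cdot> (\<eta>\<^bsub>A\<^esub> \<otimes> \<eta>\<^bsub>H\<^esub>)"

definition cross_mult :: "('o, 'm, 'z) alg_coalg_scheme \<Rightarrow> ('o, 'm, 'y) alg_scheme \<Rightarrow> 'm \<Rightarrow> 'm \<Rightarrow> 'm" where
  "cross_mult H A \<phi> \<alpha> =
     (\<mu>\<^bsub>A\<^esub> \<otimes> \<langle>ob H\<rangle>) \<cdot> (\<mu>\<^bsub>A\<^esub> \<otimes> sigma_of H \<alpha>) \<cdot> (\<langle>ob A\<rangle> \<otimes> psi H A \<phi> \<otimes> \<langle>ob H\<rangle>)"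

definition splitting :: "'o \<Rightarrow> 'm \<Rightarrow> 'o \<Rightarrow> 'm \<Rightarrow> 'm \<Rightarrow> bool" where
  "splitting Y q P p i \<longleftrightarrow>
     P \<in> Obj C \<and> p \<in> hom C Y P \<and> i \<in> hom C P Y \<and> i \<cdot> p = q \<and> p \<cdot> i = \<langle>P\<rangle>"

text \<open>In the following, \<open>P, p, i\<close> is a splitting of \<open>nabla H A \<phi>\<close>; \<open>P\<close> is the object \<open>A \<times> H\<close>.\<close>

definition assoc_algebra ::
    "('o, 'm, 'z) alg_coalg_scheme \<Rightarrow> ('o, 'm, 'y) alg_scheme \<Rightarrow> 'm \<Rightarrow> 'o \<Rightarrow> 'm \<Rightarrow> 'm \<Rightarrow> 'm \<Rightarrow> ('o, 'm) alg" where
  "assoc_algebra H A \<phi> P p i \<alpha> =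
     \<lparr> ob = P,
       unit_mor = p \<cdot> preunit H A \<phi>,
       mult_mor = p \<cdot> cross_mult H A \<phi> \<alpha> \<cdot> (i \<otimes> i) \<rparr>"

definition assoc_action ::
    "('o, 'm, 'z) alg_coalg_scheme \<Rightarrow> ('o, 'm, 'y) alg_scheme \<Rightarrow> 'm \<Rightarrow> 'm \<Rightarrow> 'm" where
  "assoc_action H A p i = p \<cdot> (\<mu>\<^bsub>A\<^esub> \<otimes> \<langle>ob H\<rangle>) \<cdot> (\<langle>ob A\<rangle> \<otimes> i)"

definition assoc_coaction ::
    "('o, 'm, 'z) alg_coalg_scheme \<Rightarrow> ('o, 'm, 'y) alg_scheme \<Rightarrow> 'm \<Rightarrow> 'm \<Rightarrow> 'm" where
  "assoc_coaction H A p i = (p \<otimes> \<langle>ob H\<rangle>) \<cdot> (\<langle>ob A\<rangle> \<otimes> \<delta>\<^bsub>H\<^esub>) \<cdot> i"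

definition isomorphism :: "'o \<Rightarrow> 'o \<Rightarrow> 'm \<Rightarrow> bool" where
  "isomorphism X Y f \<longleftrightarrow> f \<in> hom C X Y \<and> (\<exists>g \<in> hom C Y X. g \<cdot> f = \<langle>X\<rangle> \<and> f \<cdot> g = \<langle>Y\<rangle>)"

text \<open>\<open>f : X \<rightarrow> Y\<close> is compatible with binary products \<open>m\<close> on \<open>X\<close> and \<open>n\<close> on \<open>Y\<close>.\<close>

definition multiplicative :: "'m \<Rightarrow> 'm \<Rightarrow> 'm \<Rightarrow> bool" where
  "multiplicative m n f \<longleftrightarrow> f \<cdot> m = n \<cdot> (f \<otimes> f)"

definition algebra_morphism :: "('o, 'm, 'y) alg_scheme \<Rightarrow> ('o, 'm, 'z) alg_scheme \<Rightarrow> 'm \<Rightarrow> bool" where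
  "algebra_morphism A B f \<longleftrightarrow>
     f \<in> hom C (ob A) (ob B) \<and> f \<cdot> \<eta>\<^bsub>A\<^esub> = \<eta>\<^bsub>B\<^esub> \<and> multiplicative \<mu>\<^bsub>A\<^esub> \<mu>\<^bsub>B\<^esub> f"

text \<open>\<open>a\<close> and \<open>b\<close> are the left \<open>A\<close>-actions on \<open>X\<close> and \<open>Y\<close>.\<close>

definition left_module_morphism ::
    "('o, 'm, 'z) alg_scheme \<Rightarrow> 'o \<Rightarrow> 'm \<Rightarrow> 'o \<Rightarrow> 'm \<Rightarrow> 'm \<Rightarrow> bool" where
  "left_module_morphism A X a Y b f \<longleftrightarrow> f \<in> hom C X Y \<and> f \<cdot> a = b \<cdot> (\<langle>ob A\<rangle> \<otimes> f)"

text \<open>\<open>r\<close> and \<open>s\<close> are the right \<open>H\<close>-coactions on \<open>X\<close> and \<open>Y\<close>.\<close>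

definition right_comodule_morphism ::
    "('o, 'm, 'z) alg_coalg_scheme \<Rightarrow> 'o \<Rightarrow> 'm \<Rightarrow> 'o \<Rightarrow> 'm \<Rightarrow> 'm \<Rightarrow> bool" where
  "right_comodule_morphism H X r Y s f \<longleftrightarrow> f \<in> hom C X Y \<and> s \<cdot> f = (f \<otimes> \<langle>ob H\<rangle>) \<cdot> r"

definition crossed_products_equivalent ::
    "('o, 'm, 'z) alg_coalg_scheme \<Rightarrow> ('o, 'm, 'y) alg_scheme \<Rightarrow> 'm \<Rightarrow> 'o \<Rightarrow> 'm \<Rightarrow> 'm \<Rightarrow> 'm \<Rightarrow> 'm \<Rightarrow> bool" where
  "crossed_products_equivalent H A \<phi> P p i \<alpha> \<beta> \<longleftrightarrow>
     (\<exists>f. isomorphism P P f \<and>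
          algebra_morphism (assoc_algebra H A \<phi> P p i \<alpha>) (assoc_algebra H A \<phi> P p i \<beta>) f \<and>
          left_module_morphism A P (assoc_action H A p i) P (assoc_action H A p i) f \<and>
          right_comodule_morphism H P (assoc_coaction H A p i) P (assoc_coaction H A p i) f)"

definition module_comodule_endo ::
    "('o, 'm, 'z) alg_coalg_scheme \<Rightarrow> ('o, 'm, 'y) alg_scheme \<Rightarrow> 'm \<Rightarrow> bool" where
  "module_comodule_endo H A f \<longleftrightarrow>
     left_module_morphism A (ob A \<odot> ob H) (\<mu>\<^bsub>A\<^esub> \<otimes> \<langle>ob H\<rangle>) (ob A \<odot> ob H) (\<mu>\<^bsub>A\<^esub> \<otimes> \<langle>ob H\<rangle>) f \<and>
     right_comodule_morphism H (ob A \<odot> ob H) (\<langle>ob A\<rangle> \<otimes> \<delta>\<^bsub>H\<^esub>) (ob A \<odot> ob H) (\<langle>ob A\<rangle> \<otimes> \<delta>\<^bsub>H\<^esub>) f"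

end

end

theory Submission
  imports Defs
begin

text \<open>Write \<open>\<nabla>\<close> for the idempotent on \<open>A \<otimes> H\<close>, split as \<open>i \<cdot> p\<close> through \<open>A \<times> H\<close>. The two sides of the
equivalence correspond to each other by \<open>\<Gamma> = i \<cdot> f \<cdot> p\<close> and \<open>f = p \<cdot> \<Gamma> \<cdot> i\<close>, and likewise \<open>\<Gamma>'\<close> corresponds
to the inverse of \<open>f\<close>. Under this correspondence \<open>\<Gamma> \<cdot> \<Gamma>' = \<Gamma>' \<cdot> \<Gamma> = \<nabla>\<close> expresses that \<open>f\<close> is invertible,
and the remaining two identities say that \<open>\<Gamma>\<close> and \<open>\<Gamma>'\<close> absorb \<open>\<nabla>\<close>.

Both passages preserve the algebraic structure because \<open>i\<close> and \<open>p\<close> themselves are morphisms of left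
\<open>A\<close>-modules, of right \<open>H\<close>-comodules, of products and of (pre)units, between \<open>A \<otimes> H\<close> and \<open>A \<times> H\<close>;
the rest is closure of such morphisms under composition and inverses. That \<open>i\<close> and \<open>p\<close> are such
morphisms comes down to the facts that \<open>\<nabla>\<close> is \<open>A\<close>-linear (\<open>nabla_module\<close>) and \<open>H\<close>-colinear (\<open>nabla_comodule\<close>), and that
the product \<open>m\<close> of the weak crossed product satisfies \<open>\<nabla> \<cdot> m = m\<close> (\<open>nabla_m\<close>) and
\<open>m \<cdot> (\<nabla> \<otimes> \<nabla>) = m\<close> (\<open>m_nabla\<close>).

In Sweedler notation, with \<open>h\<^sub>1 \<otimes> h\<^sub>2\<close> for the coproduct of \<open>h\<close> and a dot for the action, the product is
\<open>(a \<otimes> h)(b \<otimes> k) = a (h\<^sub>1\<cdot>b) \<alpha>(h\<^sub>2,k\<^sub>1) \<otimes> h\<^sub>3k\<^sub>2\<close> and \<open>\<nabla>(a \<otimes> h) = a (h\<^sub>1\<cdot>1) \<otimes> h\<^sub>2\<close>. The absorption of \<open>\<nabla>\<close>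
on the left of \<open>m\<close> is \<open>\<alpha> \<and> u\<^sub>2 = \<alpha>\<close>, since \<open>u\<^sub>2(h,k) = hk\<cdot>1\<close>. On the first argument of \<open>m\<close> it is
\<open>(h\<^sub>1\<cdot>1)(h\<^sub>2\<cdot>b) = h\<cdot>b\<close>. On the second argument, \<open>h\<cdot>(b (k\<^sub>1\<cdot>1)) = (h\<^sub>1\<cdot>b)(h\<^sub>2\<cdot>(k\<^sub>1\<cdot>1)) = (h\<^sub>1\<cdot>b) u\<^sub>2(h\<^sub>2,k\<^sub>1)\<close>
reduces it to \<open>u\<^sub>2 \<and> \<alpha> = \<alpha>\<close>. Both identities for \<open>\<alpha>\<close> follow from its regularity and the associativity
of the convolution.\<close>

section \<open>Rewriting in strict monoidal categories\<close>

text \<open>The axioms are restated with typing premises of the form \<open>f \<in> Arr C\<close> and equalities between domains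
and codomains, so that the simplifier can discharge them. Composites and tensor products are nested
to the right, and identities of tensor products are split into factors.\<close>

context strict_monoidal_category
begin

lemma homD:
  assumes "f \<in> hom C X Y"
  shows "f \<in> Arr C" "Dom C f = X" "Cod C f = Y" "X \<in> Obj C" "Y \<in> Obj C"
  using assms Dom_Obj Cod_Obj by (auto simp: hom_def)

lemma homI: "f \<in> Arr C \<Longrightarrow> Dom C f = X \<Longrightarrow> Cod C f = Y \<Longrightarrow> f \<in> hom C X Y"
  by (simp add: hom_def)

lemma Ident_typing:
  assumes "X \<in> Obj C"
  shows "\<langle>X\<rangle> \<in> Arr C" "Dom C \<langle>X\<rangle> = X" "Cod C \<langle>X\<rangle> = X"
  using homD[OF Ident_hom[OF assms]] by auto

lemma Comp_typing:
  assumes "f \<in> Arr C" "g \<in> Arr C" "Cod C f = Dom C g"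
  shows "g \<cdot> f \<in> Arr C" "Dom C (g \<cdot> f) = Dom C f" "Cod C (g \<cdot> f) = Cod C g"
  using homD[OF Comp_hom[of f "Dom C f" "Cod C f" g "Cod C g"]] assms by (auto simp: hom_def)

lemma TensorM_typing:
  assumes "f \<in> Arr C" "g \<in> Arr C"
  shows "f \<otimes> g \<in> Arr C" "Dom C (f \<otimes> g) = Dom C f \<odot> Dom C g" "Cod C (f \<otimes> g) = Cod C f \<odot> Cod C g"
  using homD[OF TensorM_hom[of f "Dom C f" "Cod C f" g "Dom C g" "Cod C g"]] assms
  by (auto simp: hom_def)

lemmas typing = Ident_typing Comp_typing TensorM_typing Dom_Obj Cod_Obj Unit_Obj TensorO_Obj
  TensorO_assoc TensorO_Unit

lemma Comp_Comp:
  assumes "f \<in> Arr C" "g \<in> Arr C" "k \<in> Arr C" "Cod C f = Dom C g" "Cod C g = Dom C k"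
  shows "(k \<cdot> g) \<cdot> f = k \<cdot> g \<cdot> f"
  using assms by (intro Comp_assoc) (auto simp: hom_def)

lemma Comp_Ident:
  assumes "f \<in> Arr C"
  shows "Dom C f = X \<Longrightarrow> f \<cdot> \<langle>X\<rangle> = f" "Cod C f = Y \<Longrightarrow> \<langle>Y\<rangle> \<cdot> f = f"
  using assms Comp_Ident_right Comp_Ident_left by (auto simp: hom_def)

lemma Ident_TensorO: "X \<in> Obj C \<Longrightarrow> Y \<in> Obj C \<Longrightarrow> \<langle>X \<odot> Y\<rangle> = \<langle>X\<rangle> \<otimes> \<langle>Y\<rangle>"
  by (simp add: TensorM_Ident)

text \<open>The interchange law from right to left, which joins parallel composites. The variants \<open>merge21\<close> and
\<open>merge12\<close> serve right-nested tensor products in which two factors on one side face one factor on the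
other.\<close>

lemma merge:
  assumes "f \<in> Arr C" "f' \<in> Arr C" "g \<in> Arr C" "g' \<in> Arr C" "Cod C f = Dom C f'" "Cod C g = Dom C g'"
  shows "(f' \<otimes> g') \<cdot> (f \<otimes> g) = (f' \<cdot> f) \<otimes> (g' \<cdot> g)"
  using assms by (intro interchange[symmetric]) (auto simp: hom_def)

lemma merge21:
  assumes "f \<in> Arr C" "f' \<in> Arr C" "g \<in> Arr C" "g' \<in> Arr C" "k' \<in> Arr C"
    "Cod C f = Dom C f' \<odot> Dom C g'" "Cod C g = Dom C k'"
  shows "(f' \<otimes> g' \<otimes> k') \<cdot> (f \<otimes> g) = ((f' \<otimes> g') \<cdot> f) \<otimes> (k' \<cdot> g)"
  using assms merge[of f "f' \<otimes> g'" g k'] by (simp add: TensorM_assoc typing)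

lemma merge12:
  assumes "f \<in> Arr C" "f' \<in> Arr C" "g \<in> Arr C" "g' \<in> Arr C" "k' \<in> Arr C"
    "Dom C f = Cod C f' \<odot> Cod C g'" "Dom C g = Cod C k'"
  shows "(f \<otimes> g) \<cdot> (f' \<otimes> g' \<otimes> k') = (f \<cdot> (f' \<otimes> g')) \<otimes> (g \<cdot> k')"
  using assms merge[of "f' \<otimes> g'" f k' g] by (simp add: TensorM_assoc typing)

text \<open>Lifts an equation for a composite to the case where it is followed on the right by a further factor
\<open>k\<close>, as happens inside a right-nested composite.\<close>

lemma Comp_rewrite:
  assumes "x \<cdot> y = z" "x \<in> Arr C" "y \<in> Arr C" "k \<in> Arr C"
    "Cod C y = Dom C x" "Cod C k = Dom C y"
  shows "x \<cdot> y \<cdot> k = z \<cdot> k"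
  using assms Comp_Comp by metis

lemma Ident_tensor_Comp:
  assumes "f \<in> Arr C" "X \<in> Obj C" "Y \<in> Obj C"
  shows "Cod C f = X \<odot> Y \<Longrightarrow> (\<langle>X\<rangle> \<otimes> \<langle>Y\<rangle>) \<cdot> f = f"
    "Dom C f = X \<odot> Y \<Longrightarrow> f \<cdot> (\<langle>X\<rangle> \<otimes> \<langle>Y\<rangle>) = f"
    "Z \<in> Obj C \<Longrightarrow> Cod C f = X \<odot> Y \<odot> Z \<Longrightarrow> (\<langle>X\<rangle> \<otimes> \<langle>Y\<rangle> \<otimes> \<langle>Z\<rangle>) \<cdot> f = f"
    "Z \<in> Obj C \<Longrightarrow> Dom C f = X \<odot> Y \<odot> Z \<Longrightarrow> f \<cdot> (\<langle>X\<rangle> \<otimes> \<langle>Y\<rangle> \<otimes> \<langle>Z\<rangle>) = f"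
  using assms by (simp_all add: TensorM_Ident TensorO_Obj Comp_Ident)

text \<open>The interchange law in the opposite direction: a composite inside a tensor product becomes a
composite of layers. As rewrite rules these are inverse to \<open>merges\<close>, so the two must not be combined.\<close>

lemma layers:
  assumes "f \<in> Arr C" "g \<in> Arr C" "k \<in> Arr C" "Cod C f = Dom C g"
  shows "k \<otimes> (g \<cdot> f) = (\<langle>Cod C k\<rangle> \<otimes> g) \<cdot> (k \<otimes> f)"
    "(g \<cdot> f) \<otimes> k = (g \<otimes> \<langle>Cod C k\<rangle>) \<cdot> (f \<otimes> k)"
  using assms by (simp_all add: merge typing Comp_Ident)

lemma Comp3_rewrite:
  assumes "x \<cdot> y \<cdot> z = w" "x \<in> Arr C" "y \<in> Arr C" "z \<in> Arr C" "k \<in> Arr C"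
    "Cod C y = Dom C x" "Cod C z = Dom C y" "Cod C k = Dom C z"
  shows "x \<cdot> y \<cdot> z \<cdot> k = w \<cdot> k"
  using assms Comp_Comp Comp_typing by metis

lemmas merges = merge merge12 merge21
lemmas parallel = merges merges[THEN Comp_rewrite]

lemmas strict = typing Comp_Comp Comp_Ident Ident_TensorO Ident_tensor_Comp TensorM_assoc TensorM_Unit

section \<open>Composites and inverses of structure-preserving morphisms\<close>

lemma left_module_morphism_comp:
  assumes "left_module_morphism C A X r Y s f" "left_module_morphism C A Y s Z t g"
    and "ob A \<in> Obj C" "r \<in> hom C (ob A \<odot> X) X" "s \<in> hom C (ob A \<odot> Y) Y" "t \<in> hom C (ob A \<odot> Z) Z"
  shows "left_module_morphism C A X r Z t (g \<cdot> f)"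
proof -
  have f: "f \<in> hom C X Y" "f \<cdot> r = s \<cdot> (\<langle>ob A\<rangle> \<otimes> f)"
    and g: "g \<in> hom C Y Z" "g \<cdot> s = t \<cdot> (\<langle>ob A\<rangle> \<otimes> g)"
    using assms by (auto simp: left_module_morphism_def)
  note [simp] = assms(3) strict f(1)[THEN homD(1)] f(1)[THEN homD(2)] f(1)[THEN homD(3)]
    g(1)[THEN homD(1)] g(1)[THEN homD(2)] g(1)[THEN homD(3)]
    assms(4-6)[THEN homD(1)] assms(4-6)[THEN homD(2)] assms(4-6)[THEN homD(3)]
  have "(g \<cdot> f) \<cdot> r = t \<cdot> (\<langle>ob A\<rangle> \<otimes> (g \<cdot> f))"
    by (simp add: f(2) g(2)[THEN Comp_rewrite] layers)
  then show ?thesis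
    using Comp_hom[OF f(1) g(1)] by (simp add: left_module_morphism_def)
qed

lemma left_module_morphism_inverse:
  assumes "left_module_morphism C A X r Y s f" "g \<in> hom C Y X" "g \<cdot> f = \<langle>X\<rangle>" "f \<cdot> g = \<langle>Y\<rangle>"
    and "ob A \<in> Obj C" "r \<in> hom C (ob A \<odot> X) X" "s \<in> hom C (ob A \<odot> Y) Y"
  shows "left_module_morphism C A Y s X r g"
proof -
  have f: "f \<in> hom C X Y" "f \<cdot> r = s \<cdot> (\<langle>ob A\<rangle> \<otimes> f)"
    using assms by (auto simp: left_module_morphism_def)
  note [simp] = assms(5) strict f(1)[THEN homD(1)] f(1)[THEN homD(2)] f(1)[THEN homD(3)]
    assms(2,6,7)[THEN homD(1)] assms(2,6,7)[THEN homD(2)] assms(2,6,7)[THEN homD(3)]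
  note X [simp] = f(1)[THEN homD(4)] f(1)[THEN homD(5)]
  have "g \<cdot> s = g \<cdot> s \<cdot> (\<langle>ob A\<rangle> \<otimes> (f \<cdot> g))"
    using assms(4) by simp
  also have "\<dots> = (g \<cdot> f) \<cdot> r \<cdot> (\<langle>ob A\<rangle> \<otimes> g)"
    by (simp add: layers f(2)[THEN Comp_rewrite])
  also have "\<dots> = r \<cdot> (\<langle>ob A\<rangle> \<otimes> g)"
    using assms(3) by simp
  finally show ?thesis
    using assms(2) by (simp add: left_module_morphism_def)
qed

lemma right_comodule_morphism_comp:
  assumes "right_comodule_morphism C H X r Y s f" "right_comodule_morphism C H Y s Z t g"
    and "ob H \<in> Obj C" "r \<in> hom C X (X \<odot> ob H)" "s \<in> hom C Y (Y \<odot> ob H)" "t \<in> hom C Z (Z \<odot> ob H)"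
  shows "right_comodule_morphism C H X r Z t (g \<cdot> f)"
proof -
  have f: "f \<in> hom C X Y" "s \<cdot> f = (f \<otimes> \<langle>ob H\<rangle>) \<cdot> r"
    and g: "g \<in> hom C Y Z" "t \<cdot> g = (g \<otimes> \<langle>ob H\<rangle>) \<cdot> s"
    using assms by (auto simp: right_comodule_morphism_def)
  note [simp] = assms(3) strict f(1)[THEN homD(1)] f(1)[THEN homD(2)] f(1)[THEN homD(3)]
    g(1)[THEN homD(1)] g(1)[THEN homD(2)] g(1)[THEN homD(3)]
    assms(4-6)[THEN homD(1)] assms(4-6)[THEN homD(2)] assms(4-6)[THEN homD(3)]
  have "t \<cdot> g \<cdot> f = ((g \<cdot> f) \<otimes> \<langle>ob H\<rangle>) \<cdot> r"
    by (simp add: g(2)[THEN Comp_rewrite] f(2) layers)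
  then show ?thesis
    using Comp_hom[OF f(1) g(1)] by (simp add: right_comodule_morphism_def)
qed

lemma right_comodule_morphism_inverse:
  assumes "right_comodule_morphism C H X r Y s f" "g \<in> hom C Y X" "g \<cdot> f = \<langle>X\<rangle>" "f \<cdot> g = \<langle>Y\<rangle>"
    and "ob H \<in> Obj C" "r \<in> hom C X (X \<odot> ob H)" "s \<in> hom C Y (Y \<odot> ob H)"
  shows "right_comodule_morphism C H Y s X r g"
proof -
  have f: "f \<in> hom C X Y" "s \<cdot> f = (f \<otimes> \<langle>ob H\<rangle>) \<cdot> r"
    using assms by (auto simp: right_comodule_morphism_def)
  note [simp] = assms(5) strict f(1)[THEN homD(1)] f(1)[THEN homD(2)] f(1)[THEN homD(3)]
    assms(2,6,7)[THEN homD(1)] assms(2,6,7)[THEN homD(2)] assms(2,6,7)[THEN homD(3)]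
  note X [simp] = f(1)[THEN homD(4)] f(1)[THEN homD(5)]
  have "r \<cdot> g = ((g \<cdot> f) \<otimes> \<langle>ob H\<rangle>) \<cdot> r \<cdot> g"
    using assms(3) by simp
  also have "\<dots> = (g \<otimes> \<langle>ob H\<rangle>) \<cdot> s \<cdot> (f \<cdot> g)"
    by (simp add: layers f(2)[THEN Comp_rewrite])
  also have "\<dots> = (g \<otimes> \<langle>ob H\<rangle>) \<cdot> s"
    using assms(4) by simp
  finally show ?thesis
    using assms(2) by (simp add: right_comodule_morphism_def)
qed

lemma multiplicative_comp:
  assumes "multiplicative C k l f" "multiplicative C l n g"
    and "f \<in> hom C X Y" "g \<in> hom C Y Z"
    and "k \<in> hom C (X \<odot> X) X" "l \<in> hom C (Y \<odot> Y) Y" "n \<in> hom C (Z \<odot> Z) Z"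
  shows "multiplicative C k n (g \<cdot> f)"
proof -
  have f: "f \<cdot> k = l \<cdot> (f \<otimes> f)" and g: "g \<cdot> l = n \<cdot> (g \<otimes> g)"
    using assms by (auto simp: multiplicative_def)
  note [simp] = strict assms(3-7)[THEN homD(1)] assms(3-7)[THEN homD(2)] assms(3-7)[THEN homD(3)]
  show ?thesis
    by (simp add: multiplicative_def f g[THEN Comp_rewrite] merge)
qed

lemma multiplicative_inverse:
  assumes "multiplicative C k l f" "f \<in> hom C X Y" "g \<in> hom C Y X" "g \<cdot> f = \<langle>X\<rangle>" "f \<cdot> g = \<langle>Y\<rangle>"
    and "k \<in> hom C (X \<odot> X) X" "l \<in> hom C (Y \<odot> Y) Y"
  shows "multiplicative C l k g"
proof -
  have f: "f \<cdot> k = l \<cdot> (f \<otimes> f)"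
    using assms by (auto simp: multiplicative_def)
  note [simp] = strict assms(2,3,6,7)[THEN homD(1)] assms(2,3,6,7)[THEN homD(2)] assms(2,3,6,7)[THEN homD(3)]
    assms(2)[THEN homD(4)] assms(2)[THEN homD(5)]
  have "g \<cdot> l = g \<cdot> l \<cdot> ((f \<cdot> g) \<otimes> (f \<cdot> g))"
    using assms(5) by simp
  also have "\<dots> = g \<cdot> (f \<cdot> k) \<cdot> (g \<otimes> g)"
    unfolding f by (simp add: merge)
  also have "\<dots> = (g \<cdot> f) \<cdot> k \<cdot> (g \<otimes> g)"
    by simp
  also have "\<dots> = k \<cdot> (g \<otimes> g)"
    using assms(4) by simp
  finally show ?thesis
    by (simp add: multiplicative_def)
qed

end

section \<open>Identities for the symmetry\<close>

context strict_symmetric_monoidal_category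
begin

lemma Sym_typing:
  assumes "X \<in> Obj C" "Y \<in> Obj C"
  shows "\<c> X Y \<in> Arr C" "Dom C (\<c> X Y) = X \<odot> Y" "Cod C (\<c> X Y) = Y \<odot> X"
  using homD[OF Sym_hom[OF assms]] by auto

lemma Sym_slide:
  assumes "f \<in> Arr C" "g \<in> Arr C"
  shows "\<c> (Cod C f) (Cod C g) \<cdot> (f \<otimes> g) = (g \<otimes> f) \<cdot> \<c> (Dom C f) (Dom C g)"
  using assms by (intro Sym_natural) (auto simp: hom_def)

lemma hexagon':
  assumes "X \<in> Obj C" "Y \<in> Obj C" "Z \<in> Obj C"
  shows "\<c> (X \<odot> Y) Z = (\<c> X Z \<otimes> \<langle>Y\<rangle>) \<cdot> (\<langle>X\<rangle> \<otimes> \<c> Y Z)"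
proof -
  let ?r = "(\<c> X Z \<otimes> \<langle>Y\<rangle>) \<cdot> (\<langle>X\<rangle> \<otimes> \<c> Y Z)"
  note [simp] = assms strict Sym_typing
  have "(\<c> X Z \<otimes> \<langle>Y\<rangle>) \<cdot> (\<langle>X\<rangle> \<otimes> \<c> Y Z) \<cdot> (\<langle>X\<rangle> \<otimes> \<c> Z Y) \<cdot> (\<c> Z X \<otimes> \<langle>Y\<rangle>)
      = \<langle>Z \<odot> X \<odot> Y\<rangle>"
    by (simp add: parallel Sym_inverse)
  then have i: "?r \<cdot> \<c> Z (X \<odot> Y) = \<langle>Z \<odot> X \<odot> Y\<rangle>"
    by (simp add: hexagon)
  have "?r = ?r \<cdot> \<c> Z (X \<odot> Y) \<cdot> \<c> (X \<odot> Y) Z"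
    by (subst Sym_inverse) (simp_all del: Ident_TensorO)
  also have "\<dots> = (?r \<cdot> \<c> Z (X \<odot> Y)) \<cdot> \<c> (X \<odot> Y) Z"
    by simp
  also have "\<dots> = \<c> (X \<odot> Y) Z"
    unfolding i by (simp del: Ident_TensorO)
  finally show ?thesis by simp
qed

lemma Sym_Unit: "X \<in> Obj C \<Longrightarrow> \<c> X (Unit C) = \<langle>X\<rangle>"
proof -
  assume X: "X \<in> Obj C"
  note [simp] = X strict Sym_typing
  let ?c = "\<c> X (Unit C)"
  have "?c \<cdot> ?c = ?c"
    using hexagon[of X "Unit C" "Unit C"] by simp
  then have "\<c> (Unit C) X \<cdot> ?c \<cdot> ?c = \<c> (Unit C) X \<cdot> ?c" by simp
  then have "(\<c> (Unit C) X \<cdot> ?c) \<cdot> ?c = \<c> (Unit C) X \<cdot> ?c" by simp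
  then show ?thesis by (subst (asm) (1 2) Sym_inverse) simp_all
qed

end

section \<open>The idempotent on the tensor product\<close>

text \<open>Only the structure on \<open>H\<close> and \<open>A\<close> is fixed here. The objects of \<open>H\<close> and \<open>A\<close> are written \<open>h\<close> and \<open>a\<close>, the
coproduct of \<open>H \<otimes> H\<close> is \<open>\<delta>\<delta>\<close>, and \<open>v\<close>, \<open>N\<close> stand for \<open>u\<^sub>1\<close> and the idempotent \<open>\<nabla>\<close>.\<close>

locale crossed_product_data = strict_symmetric_monoidal_category +
  fixes H :: "('a, 'b) alg_coalg" and A :: "('a, 'b) alg" and \<phi> :: 'b
  assumes H: "weak_Hopf_algebra C H"
    and A: "weak_left_module_algebra C H A \<phi>"
begin

abbreviation h where "h \<equiv> ob H"
abbreviation a where "a \<equiv> ob A"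
abbreviation \<delta>\<delta> where "\<delta>\<delta> \<equiv> comult2 C H"
abbreviation \<psi> where "\<psi> \<equiv> psi C H A \<phi>"
abbreviation v where "v \<equiv> u1 C H A \<phi>"
abbreviation N where "N \<equiv> nabla C H A \<phi>"

lemma homs:
  "\<eta>\<^bsub>H\<^esub> \<in> hom C (Unit C) h" "\<mu>\<^bsub>H\<^esub> \<in> hom C (h \<odot> h) h" "\<delta>\<^bsub>H\<^esub> \<in> hom C h (h \<odot> h)"
  "\<eta>\<^bsub>A\<^esub> \<in> hom C (Unit C) a" "\<mu>\<^bsub>A\<^esub> \<in> hom C (a \<odot> a) a" "\<phi> \<in> hom C (h \<odot> a) a"
  using H A unfolding weak_Hopf_algebra_def weak_left_module_algebra_def algebra_def coalgebra_def
  by auto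

lemma objs [simp]: "h \<in> Obj C" "a \<in> Obj C"
  using homs homD by blast+

lemmas data_typing [simp] = homs[THEN homD(1)] homs[THEN homD(2)] homs[THEN homD(3)] Sym_typing

declare strict [simp]

lemma mult_unit_left: "\<mu>\<^bsub>A\<^esub> \<cdot> (\<eta>\<^bsub>A\<^esub> \<otimes> \<langle>a\<rangle>) = \<langle>a\<rangle>"
  and mult_assoc: "\<mu>\<^bsub>A\<^esub> \<cdot> (\<mu>\<^bsub>A\<^esub> \<otimes> \<langle>a\<rangle>) = \<mu>\<^bsub>A\<^esub> \<cdot> (\<langle>a\<rangle> \<otimes> \<mu>\<^bsub>A\<^esub>)"
  and comult_coassoc: "(\<delta>\<^bsub>H\<^esub> \<otimes> \<langle>h\<rangle>) \<cdot> \<delta>\<^bsub>H\<^esub> = (\<langle>h\<rangle> \<otimes> \<delta>\<^bsub>H\<^esub>) \<cdot> \<delta>\<^bsub>H\<^esub>"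
  and comult_mult: "\<delta>\<^bsub>H\<^esub> \<cdot> \<mu>\<^bsub>H\<^esub> = (\<mu>\<^bsub>H\<^esub> \<otimes> \<mu>\<^bsub>H\<^esub>) \<cdot> \<delta>\<delta>"
  and action_mult: "\<phi> \<cdot> (\<langle>h\<rangle> \<otimes> \<mu>\<^bsub>A\<^esub>) =
       \<mu>\<^bsub>A\<^esub> \<cdot> (\<phi> \<otimes> \<phi>) \<cdot> (\<langle>h\<rangle> \<otimes> \<c> h a \<otimes> \<langle>a\<rangle>) \<cdot> (\<delta>\<^bsub>H\<^esub> \<otimes> \<langle>a\<rangle> \<otimes> \<langle>a\<rangle>)"
  and action_action_unit: "\<phi> \<cdot> (\<mu>\<^bsub>H\<^esub> \<otimes> \<eta>\<^bsub>A\<^esub>) = \<phi> \<cdot> (\<langle>h\<rangle> \<otimes> (\<phi> \<cdot> (\<langle>h\<rangle> \<otimes> \<eta>\<^bsub>A\<^esub>)))"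
  using H A unfolding weak_Hopf_algebra_def weak_left_module_algebra_def algebra_def coalgebra_def
  by auto

lemma v_typing [simp]: "v \<in> Arr C" "Dom C v = h" "Cod C v = a"
  by (simp_all add: u1_def)

lemma comult2_typing [simp]: "\<delta>\<delta> \<in> Arr C" "Dom C \<delta>\<delta> = h \<odot> h" "Cod C \<delta>\<delta> = h \<odot> h \<odot> h \<odot> h"
  by (simp_all add: comult2_def tensor_comult_def)

lemma psi_typing [simp]: "\<psi> \<in> Arr C" "Dom C \<psi> = h \<odot> a" "Cod C \<psi> = a \<odot> h"
  by (simp_all add: psi_def)

lemma comult2_coassoc:
  "(\<delta>\<delta> \<otimes> \<langle>h\<rangle> \<otimes> \<langle>h\<rangle>) \<cdot> \<delta>\<delta> = (\<langle>h\<rangle> \<otimes> \<langle>h\<rangle> \<otimes> \<delta>\<delta>) \<cdot> \<delta>\<delta>"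
proof -
  define P where "P = (\<langle>h\<rangle> \<otimes> \<c> h h \<otimes> \<langle>h\<rangle> \<otimes> \<langle>h\<rangle> \<otimes> \<langle>h\<rangle>) \<cdot> (\<langle>h\<rangle> \<otimes> \<langle>h\<rangle> \<otimes> \<langle>h\<rangle> \<otimes> \<c> h h \<otimes> \<langle>h\<rangle>) \<cdot> (\<langle>h\<rangle> \<otimes> \<langle>h\<rangle> \<otimes> \<c> h h \<otimes> \<langle>h\<rangle> \<otimes> \<langle>h\<rangle>)"
  \<comment> \<open>\<open>P\<close> rearranges \<open>h\<^sub>1 h\<^sub>2 h\<^sub>3 k\<^sub>1 k\<^sub>2 k\<^sub>3\<close> into \<open>h\<^sub>1 k\<^sub>1 h\<^sub>2 k\<^sub>2 h\<^sub>3 k\<^sub>3\<close>; both sides equal \<open>P\<close> after the iterated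
    coproducts of the two factors.\<close>
  have s1: "(\<delta>\<^bsub>H\<^esub> \<otimes> \<langle>h\<rangle>) \<cdot> \<c> h h
      = (\<langle>h\<rangle> \<otimes> \<c> h h) \<cdot> (\<c> h h \<otimes> \<langle>h\<rangle>) \<cdot> (\<langle>h\<rangle> \<otimes> \<delta>\<^bsub>H\<^esub>)"
    using Sym_slide[of "\<langle>h\<rangle>" "\<delta>\<^bsub>H\<^esub>"] by (simp add: hexagon)
  have s2: "(\<langle>h\<rangle> \<otimes> \<delta>\<^bsub>H\<^esub>) \<cdot> \<c> h h
      = (\<c> h h \<otimes> \<langle>h\<rangle>) \<cdot> (\<langle>h\<rangle> \<otimes> \<c> h h) \<cdot> (\<delta>\<^bsub>H\<^esub> \<otimes> \<langle>h\<rangle>)"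
    using Sym_slide[of "\<delta>\<^bsub>H\<^esub>" "\<langle>h\<rangle>"] by (simp add: hexagon')
  have sw: "(\<langle>h\<rangle> \<otimes> \<langle>h\<rangle> \<otimes> \<langle>h\<rangle> \<otimes> \<c> h h \<otimes> \<langle>h\<rangle>) \<cdot> (\<langle>h\<rangle> \<otimes> \<c> h h \<otimes> \<langle>h\<rangle> \<otimes> \<langle>h\<rangle> \<otimes> \<langle>h\<rangle>)
    = (\<langle>h\<rangle> \<otimes> \<c> h h \<otimes> \<langle>h\<rangle> \<otimes> \<langle>h\<rangle> \<otimes> \<langle>h\<rangle>) \<cdot> (\<langle>h\<rangle> \<otimes> \<langle>h\<rangle> \<otimes> \<langle>h\<rangle> \<otimes> \<c> h h \<otimes> \<langle>h\<rangle>)"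
    by (simp add: merges)
  have "(\<delta>\<delta> \<otimes> \<langle>h\<rangle> \<otimes> \<langle>h\<rangle>) \<cdot> \<delta>\<delta> =
     (\<langle>h\<rangle> \<otimes> \<c> h h \<otimes> \<langle>h\<rangle> \<otimes> \<langle>h\<rangle> \<otimes> \<langle>h\<rangle>) \<cdot> (\<delta>\<^bsub>H\<^esub> \<otimes> ((\<delta>\<^bsub>H\<^esub> \<otimes> \<langle>h\<rangle>) \<cdot> \<c> h h) \<otimes> \<langle>h\<rangle>) \<cdot> (\<delta>\<^bsub>H\<^esub> \<otimes> \<delta>\<^bsub>H\<^esub>)"
    by (simp add: comult2_def tensor_comult_def layers) (simp add: parallel)
  also have "\<dots> = P \<cdot> (\<delta>\<^bsub>H\<^esub> \<otimes> \<langle>h\<rangle> \<otimes> \<delta>\<^bsub>H\<^esub> \<otimes> \<langle>h\<rangle>) \<cdot> (\<delta>\<^bsub>H\<^esub> \<otimes> \<delta>\<^bsub>H\<^esub>)"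
    unfolding s1 P_def by (simp add: layers)
  also have "(\<delta>\<^bsub>H\<^esub> \<otimes> \<langle>h\<rangle> \<otimes> \<delta>\<^bsub>H\<^esub> \<otimes> \<langle>h\<rangle>) \<cdot> (\<delta>\<^bsub>H\<^esub> \<otimes> \<delta>\<^bsub>H\<^esub>)
      = (\<langle>h\<rangle> \<otimes> \<delta>\<^bsub>H\<^esub> \<otimes> \<langle>h\<rangle> \<otimes> \<delta>\<^bsub>H\<^esub>) \<cdot> (\<delta>\<^bsub>H\<^esub> \<otimes> \<delta>\<^bsub>H\<^esub>)"
    by (simp add: merges comult_coassoc)
  finally have 1: "(\<delta>\<delta> \<otimes> \<langle>h\<rangle> \<otimes> \<langle>h\<rangle>) \<cdot> \<delta>\<delta> = P \<cdot> (\<langle>h\<rangle> \<otimes> \<delta>\<^bsub>H\<^esub> \<otimes> \<langle>h\<rangle> \<otimes> \<delta>\<^bsub>H\<^esub>) \<cdot> (\<delta>\<^bsub>H\<^esub> \<otimes> \<delta>\<^bsub>H\<^esub>)" .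
  have "(\<langle>h\<rangle> \<otimes> \<langle>h\<rangle> \<otimes> \<delta>\<delta>) \<cdot> \<delta>\<delta> =
     (\<langle>h\<rangle> \<otimes> \<langle>h\<rangle> \<otimes> \<langle>h\<rangle> \<otimes> \<c> h h \<otimes> \<langle>h\<rangle>) \<cdot> (\<langle>h\<rangle> \<otimes> ((\<langle>h\<rangle> \<otimes> \<delta>\<^bsub>H\<^esub>) \<cdot> \<c> h h) \<otimes> \<delta>\<^bsub>H\<^esub>) \<cdot> (\<delta>\<^bsub>H\<^esub> \<otimes> \<delta>\<^bsub>H\<^esub>)"
    by (simp add: comult2_def tensor_comult_def layers) (simp add: parallel)
  also have "\<dots> = P \<cdot> (\<langle>h\<rangle> \<otimes> \<delta>\<^bsub>H\<^esub> \<otimes> \<langle>h\<rangle> \<otimes> \<delta>\<^bsub>H\<^esub>) \<cdot> (\<delta>\<^bsub>H\<^esub> \<otimes> \<delta>\<^bsub>H\<^esub>)"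
    unfolding s2 P_def by (simp add: layers sw[THEN Comp_rewrite])
  finally show ?thesis unfolding 1 by simp
qed

text \<open>In elements: \<open>h\<^sub>1\<cdot>(bc) \<otimes> h\<^sub>2 = (h\<^sub>1\<cdot>b)(h\<^sub>2\<cdot>c) \<otimes> h\<^sub>3\<close>.\<close>

lemma psi_mult:
  "\<psi> \<cdot> (\<langle>h\<rangle> \<otimes> \<mu>\<^bsub>A\<^esub>) = (\<mu>\<^bsub>A\<^esub> \<otimes> \<langle>h\<rangle>) \<cdot> (\<langle>a\<rangle> \<otimes> \<psi>) \<cdot> (\<psi> \<otimes> \<langle>a\<rangle>)"
proof -
  define Q where "Q = (\<mu>\<^bsub>A\<^esub> \<otimes> \<langle>h\<rangle>) \<cdot> (\<phi> \<otimes> \<phi> \<otimes> \<langle>h\<rangle>) \<cdot> (\<langle>h\<rangle> \<otimes> \<c> h a \<otimes> \<c> h a) \<cdot> (\<langle>h\<rangle> \<otimes> \<langle>h\<rangle> \<otimes> \<c> h a \<otimes> \<langle>a\<rangle>)"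
  \<comment> \<open>\<open>Q\<close> sends \<open>h\<^sub>1 h\<^sub>2 h\<^sub>3 b c\<close> to \<open>(h\<^sub>1\<cdot>b)(h\<^sub>2\<cdot>c) \<otimes> h\<^sub>3\<close>.\<close>
  have s1: "\<c> h a \<cdot> (\<langle>h\<rangle> \<otimes> \<mu>\<^bsub>A\<^esub>)
      = (\<mu>\<^bsub>A\<^esub> \<otimes> \<langle>h\<rangle>) \<cdot> (\<langle>a\<rangle> \<otimes> \<c> h a) \<cdot> (\<c> h a \<otimes> \<langle>a\<rangle>)"
    using Sym_slide[of "\<langle>h\<rangle>" "\<mu>\<^bsub>A\<^esub>"] by (simp add: hexagon)
  have s2: "(\<langle>a\<rangle> \<otimes> \<delta>\<^bsub>H\<^esub>) \<cdot> \<c> h a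
      = (\<c> h a \<otimes> \<langle>h\<rangle>) \<cdot> (\<langle>h\<rangle> \<otimes> \<c> h a) \<cdot> (\<delta>\<^bsub>H\<^esub> \<otimes> \<langle>a\<rangle>)"
    using Sym_slide[of "\<delta>\<^bsub>H\<^esub>" "\<langle>a\<rangle>"] by (simp add: hexagon')
  have s3: "\<langle>h\<rangle> \<otimes> \<c> h a \<otimes> \<c> h a
      = (\<langle>h\<rangle> \<otimes> \<langle>a\<rangle> \<otimes> \<langle>h\<rangle> \<otimes> \<c> h a) \<cdot> (\<langle>h\<rangle> \<otimes> \<c> h a \<otimes> \<langle>h\<rangle> \<otimes> \<langle>a\<rangle>)"
    by (simp add: parallel)
  have s3': "\<langle>h\<rangle> \<otimes> \<c> h a \<otimes> \<c> h a
      = (\<langle>h\<rangle> \<otimes> \<c> h a \<otimes> \<langle>a\<rangle> \<otimes> \<langle>h\<rangle>) \<cdot> (\<langle>h\<rangle> \<otimes> \<langle>h\<rangle> \<otimes> \<langle>a\<rangle> \<otimes> \<c> h a)"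
    by (simp add: parallel)
  have e1: "\<phi> \<otimes> \<psi>
      = (\<phi> \<otimes> \<phi> \<otimes> \<langle>h\<rangle>) \<cdot> (\<langle>h\<rangle> \<otimes> \<langle>a\<rangle> \<otimes> \<langle>h\<rangle> \<otimes> \<c> h a) \<cdot> (\<langle>h\<rangle> \<otimes> \<langle>a\<rangle> \<otimes> \<delta>\<^bsub>H\<^esub> \<otimes> \<langle>a\<rangle>)"
    by (simp add: psi_def parallel)
  have e2: "\<psi> \<otimes> \<langle>a\<rangle>
      = (\<phi> \<otimes> \<langle>h\<rangle> \<otimes> \<langle>a\<rangle>) \<cdot> (\<langle>h\<rangle> \<otimes> \<c> h a \<otimes> \<langle>a\<rangle>) \<cdot> (\<delta>\<^bsub>H\<^esub> \<otimes> \<langle>a\<rangle> \<otimes> \<langle>a\<rangle>)"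
    by (simp add: psi_def layers)
  have e3: "(\<langle>a\<rangle> \<otimes> \<psi>) \<cdot> (\<phi> \<otimes> \<langle>h\<rangle> \<otimes> \<langle>a\<rangle>) = \<phi> \<otimes> \<psi>"
    by (simp add: parallel)
  have slide: "(\<delta>\<^bsub>H\<^esub> \<otimes> \<langle>a\<rangle> \<otimes> \<langle>a\<rangle> \<otimes> \<langle>h\<rangle>) \<cdot> (\<langle>h\<rangle> \<otimes> \<langle>a\<rangle> \<otimes> \<c> h a) \<cdot> (\<langle>h\<rangle> \<otimes> \<c> h a \<otimes> \<langle>a\<rangle>)
     = (\<langle>h\<rangle> \<otimes> \<langle>h\<rangle> \<otimes> \<langle>a\<rangle> \<otimes> \<c> h a) \<cdot> (\<langle>h\<rangle> \<otimes> \<langle>h\<rangle> \<otimes> \<c> h a \<otimes> \<langle>a\<rangle>) \<cdot> (\<delta>\<^bsub>H\<^esub> \<otimes> \<langle>h\<rangle> \<otimes> \<langle>a\<rangle> \<otimes> \<langle>a\<rangle>)"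
    by (simp add: parallel)
  have "\<psi> \<cdot> (\<langle>h\<rangle> \<otimes> \<mu>\<^bsub>A\<^esub>)
      = (\<phi> \<otimes> \<langle>h\<rangle>) \<cdot> (\<langle>h\<rangle> \<otimes> (\<c> h a \<cdot> (\<langle>h\<rangle> \<otimes> \<mu>\<^bsub>A\<^esub>))) \<cdot> (\<delta>\<^bsub>H\<^esub> \<otimes> \<langle>a\<rangle> \<otimes> \<langle>a\<rangle>)"
    by (simp add: psi_def layers) (simp add: parallel)
  also have "\<dots> = ((\<phi> \<cdot> (\<langle>h\<rangle> \<otimes> \<mu>\<^bsub>A\<^esub>)) \<otimes> \<langle>h\<rangle>) \<cdot> (\<langle>h\<rangle> \<otimes> \<langle>a\<rangle> \<otimes> \<c> h a) \<cdot> (\<langle>h\<rangle> \<otimes> \<c> h a \<otimes> \<langle>a\<rangle>) \<cdot> (\<delta>\<^bsub>H\<^esub> \<otimes> \<langle>a\<rangle> \<otimes> \<langle>a\<rangle>)"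
    unfolding s1 by (simp add: layers)
  also have "\<dots> = Q \<cdot> (((\<delta>\<^bsub>H\<^esub> \<otimes> \<langle>h\<rangle>) \<cdot> \<delta>\<^bsub>H\<^esub>) \<otimes> \<langle>a\<rangle> \<otimes> \<langle>a\<rangle>)"
    unfolding action_mult Q_def s3' by (simp add: layers slide[THEN Comp3_rewrite])
  also have "\<dots> = Q \<cdot> (((\<langle>h\<rangle> \<otimes> \<delta>\<^bsub>H\<^esub>) \<cdot> \<delta>\<^bsub>H\<^esub>) \<otimes> \<langle>a\<rangle> \<otimes> \<langle>a\<rangle>)"
    unfolding comult_coassoc ..
  also have "\<dots> = (\<mu>\<^bsub>A\<^esub> \<otimes> \<langle>h\<rangle>) \<cdot> (\<phi> \<otimes> \<phi> \<otimes> \<langle>h\<rangle>) \<cdot> (\<langle>h\<rangle> \<otimes> \<langle>a\<rangle> \<otimes> \<langle>h\<rangle> \<otimes> \<c> h a) \<cdot> (\<langle>h\<rangle> \<otimes> ((\<langle>a\<rangle> \<otimes> \<delta>\<^bsub>H\<^esub>) \<cdot> \<c> h a) \<otimes> \<langle>a\<rangle>) \<cdot> (\<delta>\<^bsub>H\<^esub> \<otimes> \<langle>a\<rangle> \<otimes> \<langle>a\<rangle>)"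
    unfolding s2 Q_def s3 by (simp add: layers)
  also have "\<dots> = (\<mu>\<^bsub>A\<^esub> \<otimes> \<langle>h\<rangle>) \<cdot> (\<phi> \<otimes> \<psi>) \<cdot> (\<langle>h\<rangle> \<otimes> \<c> h a \<otimes> \<langle>a\<rangle>) \<cdot> (\<delta>\<^bsub>H\<^esub> \<otimes> \<langle>a\<rangle> \<otimes> \<langle>a\<rangle>)"
    unfolding e1 by (simp add: layers)
  also have "\<dots> = (\<mu>\<^bsub>A\<^esub> \<otimes> \<langle>h\<rangle>) \<cdot> (\<langle>a\<rangle> \<otimes> \<psi>) \<cdot> (\<psi> \<otimes> \<langle>a\<rangle>)"
    by (simp add: e2 e3[THEN Comp_rewrite])
  finally show ?thesis .
qed

text \<open>The map \<open>h \<mapsto> (h\<^sub>1\<cdot>1) \<otimes> h\<^sub>2\<close>, that is, the restriction of \<open>\<nabla>\<close> along \<open>h \<mapsto> 1 \<otimes> h\<close>; by \<open>nabla_eq\<close> it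
determines \<open>\<nabla>\<close>.\<close>

definition j where "j = (v \<otimes> \<langle>h\<rangle>) \<cdot> \<delta>\<^bsub>H\<^esub>"

lemma j_typing [simp]: "j \<in> Arr C" "Dom C j = h" "Cod C j = a \<odot> h"
  by (simp_all add: j_def)

lemma psi_unit: "\<psi> \<cdot> (\<langle>h\<rangle> \<otimes> \<eta>\<^bsub>A\<^esub>) = j"
proof -
  have s: "\<c> h a \<cdot> (\<langle>h\<rangle> \<otimes> \<eta>\<^bsub>A\<^esub>) = \<eta>\<^bsub>A\<^esub> \<otimes> \<langle>h\<rangle>"
    using Sym_slide[of "\<langle>h\<rangle>" "\<eta>\<^bsub>A\<^esub>"] by (simp add: Sym_Unit)
  have d: "(\<delta>\<^bsub>H\<^esub> \<otimes> \<langle>a\<rangle>) \<cdot> (\<langle>h\<rangle> \<otimes> \<eta>\<^bsub>A\<^esub>)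
      = (\<langle>h\<rangle> \<otimes> \<langle>h\<rangle> \<otimes> \<eta>\<^bsub>A\<^esub>) \<cdot> \<delta>\<^bsub>H\<^esub>"
    using merge[of "\<delta>\<^bsub>H\<^esub>" "\<langle>h\<rangle> \<otimes> \<langle>h\<rangle>" "\<langle>Unit C\<rangle>" "\<eta>\<^bsub>A\<^esub>"] by (simp add: merge)
  have "\<psi> \<cdot> (\<langle>h\<rangle> \<otimes> \<eta>\<^bsub>A\<^esub>)
      = (\<phi> \<otimes> \<langle>h\<rangle>) \<cdot> (\<langle>h\<rangle> \<otimes> (\<c> h a \<cdot> (\<langle>h\<rangle> \<otimes> \<eta>\<^bsub>A\<^esub>))) \<cdot> \<delta>\<^bsub>H\<^esub>"
    by (simp add: psi_def layers d)
  also have "\<dots> = j" unfolding s by (simp add: j_def u1_def layers)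
  finally show ?thesis .
qed

lemma nabla_eq: "N = (\<mu>\<^bsub>A\<^esub> \<otimes> \<langle>h\<rangle>) \<cdot> (\<langle>a\<rangle> \<otimes> j)"
  by (simp add: nabla_def psi_unit[symmetric] layers)

lemma nabla_typing [simp]: "N \<in> Arr C" "Dom C N = a \<odot> h" "Cod C N = a \<odot> h"
  by (simp_all add: nabla_eq)

lemma nabla_module: "N \<cdot> (\<mu>\<^bsub>A\<^esub> \<otimes> \<langle>h\<rangle>) = (\<mu>\<^bsub>A\<^esub> \<otimes> \<langle>h\<rangle>) \<cdot> (\<langle>a\<rangle> \<otimes> N)"
proof -
  have "N \<cdot> (\<mu>\<^bsub>A\<^esub> \<otimes> \<langle>h\<rangle>)
      = ((\<mu>\<^bsub>A\<^esub> \<cdot> (\<mu>\<^bsub>A\<^esub> \<otimes> \<langle>a\<rangle>)) \<otimes> \<langle>h\<rangle>) \<cdot> (\<langle>a\<rangle> \<otimes> \<langle>a\<rangle> \<otimes> j)"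
    by (simp add: nabla_eq layers) (simp add: parallel)
  also have "\<dots> = (\<mu>\<^bsub>A\<^esub> \<otimes> \<langle>h\<rangle>) \<cdot> (\<langle>a\<rangle> \<otimes> N)"
    unfolding mult_assoc by (simp add: nabla_eq layers)
  finally show ?thesis .
qed

lemma nabla_comodule: "(\<langle>a\<rangle> \<otimes> \<delta>\<^bsub>H\<^esub>) \<cdot> N = (N \<otimes> \<langle>h\<rangle>) \<cdot> (\<langle>a\<rangle> \<otimes> \<delta>\<^bsub>H\<^esub>)"
proof -
  have s: "(\<langle>a\<rangle> \<otimes> \<delta>\<^bsub>H\<^esub>) \<cdot> (\<mu>\<^bsub>A\<^esub> \<otimes> \<langle>h\<rangle>) \<cdot> (\<langle>a\<rangle> \<otimes> v \<otimes> \<langle>h\<rangle>)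
      = (\<mu>\<^bsub>A\<^esub> \<otimes> \<langle>h\<rangle> \<otimes> \<langle>h\<rangle>) \<cdot> (\<langle>a\<rangle> \<otimes> v \<otimes> \<langle>h\<rangle> \<otimes> \<langle>h\<rangle>) \<cdot> (\<langle>a\<rangle> \<otimes> \<langle>h\<rangle> \<otimes> \<delta>\<^bsub>H\<^esub>)"
    by (simp add: parallel)
  have "(\<langle>a\<rangle> \<otimes> \<delta>\<^bsub>H\<^esub>) \<cdot> N
      = (\<mu>\<^bsub>A\<^esub> \<otimes> \<langle>h\<rangle> \<otimes> \<langle>h\<rangle>) \<cdot> (\<langle>a\<rangle> \<otimes> v \<otimes> \<langle>h\<rangle> \<otimes> \<langle>h\<rangle>) \<cdot> (\<langle>a\<rangle> \<otimes> ((\<langle>h\<rangle> \<otimes> \<delta>\<^bsub>H\<^esub>) \<cdot> \<delta>\<^bsub>H\<^esub>))"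
    by (simp add: nabla_eq j_def layers s[THEN Comp3_rewrite])
  also have "\<dots> = (N \<otimes> \<langle>h\<rangle>) \<cdot> (\<langle>a\<rangle> \<otimes> \<delta>\<^bsub>H\<^esub>)"
    unfolding comult_coassoc[symmetric] by (simp add: nabla_eq j_def layers)
  finally show ?thesis .
qed

section \<open>Convolution with the trivial cochain\<close>

abbreviation u where "u \<equiv> u2 C H A \<phi>"
abbreviation convolution (infixl "\<star>" 65) where "f \<star> g \<equiv> conv C \<delta>\<delta> \<mu>\<^bsub>A\<^esub> f g"

lemma u_eq: "u = v \<cdot> \<mu>\<^bsub>H\<^esub>"
proof -
  have "\<mu>\<^bsub>H\<^esub> \<otimes> \<eta>\<^bsub>A\<^esub> = (\<langle>h\<rangle> \<otimes> \<eta>\<^bsub>A\<^esub>) \<cdot> \<mu>\<^bsub>H\<^esub>"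
    using merge[of "\<mu>\<^bsub>H\<^esub>" "\<langle>h\<rangle>" "\<langle>Unit C\<rangle>" "\<eta>\<^bsub>A\<^esub>"] by simp
  then show ?thesis by (simp add: u1_def u2_def)
qed

lemma u_typing [simp]: "u \<in> Arr C" "Dom C u = h \<odot> h" "Cod C u = a"
  by (simp_all add: u_eq)

lemma conv_assoc:
  assumes "f \<in> hom C (h \<odot> h) a" "g \<in> hom C (h \<odot> h) a" "k \<in> hom C (h \<odot> h) a"
  shows "(f \<star> g) \<star> k = f \<star> (g \<star> k)"
proof -
  note [simp] = assms[THEN homD(1)] assms[THEN homD(2)] assms[THEN homD(3)]
  have "(f \<star> g) \<star> k
      = (\<mu>\<^bsub>A\<^esub> \<cdot> (\<mu>\<^bsub>A\<^esub> \<otimes> \<langle>a\<rangle>)) \<cdot> (f \<otimes> g \<otimes> k) \<cdot> (\<delta>\<delta> \<otimes> \<langle>h\<rangle> \<otimes> \<langle>h\<rangle>) \<cdot> \<delta>\<delta>"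
    by (simp add: conv_def) (simp add: parallel)
  also have "\<dots> = f \<star> (g \<star> k)"
    unfolding comult2_coassoc mult_assoc by (simp add: conv_def) (simp add: parallel)
  finally show ?thesis .
qed

text \<open>In elements: \<open>f(h\<^sub>1,k\<^sub>1) g(h\<^sub>2,k\<^sub>2) \<otimes> h\<^sub>3k\<^sub>3 = (f \<and> g)(h\<^sub>1,k\<^sub>1) \<otimes> h\<^sub>2k\<^sub>2\<close>.\<close>

lemma conv_mult:
  assumes "f \<in> hom C (h \<odot> h) a" "g \<in> hom C (h \<odot> h) a"
  shows "(\<mu>\<^bsub>A\<^esub> \<otimes> \<langle>h\<rangle>) \<cdot> (f \<otimes> ((g \<otimes> \<mu>\<^bsub>H\<^esub>) \<cdot> \<delta>\<delta>)) \<cdot> \<delta>\<delta>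
      = ((f \<star> g) \<otimes> \<mu>\<^bsub>H\<^esub>) \<cdot> \<delta>\<delta>"
proof -
  note [simp] = assms[THEN homD(1)] assms[THEN homD(2)] assms[THEN homD(3)]
  have "(\<mu>\<^bsub>A\<^esub> \<otimes> \<langle>h\<rangle>) \<cdot> (f \<otimes> ((g \<otimes> \<mu>\<^bsub>H\<^esub>) \<cdot> \<delta>\<delta>)) \<cdot> \<delta>\<delta>
    = (\<mu>\<^bsub>A\<^esub> \<otimes> \<langle>h\<rangle>) \<cdot> (f \<otimes> g \<otimes> \<mu>\<^bsub>H\<^esub>) \<cdot> (\<langle>h\<rangle> \<otimes> \<langle>h\<rangle> \<otimes> \<delta>\<delta>) \<cdot> \<delta>\<delta>"
    by (simp add: parallel)
  also have "\<dots> = ((f \<star> g) \<otimes> \<mu>\<^bsub>H\<^esub>) \<cdot> \<delta>\<delta>"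
    unfolding comult2_coassoc[symmetric] by (simp add: conv_def parallel)
  finally show ?thesis .
qed

text \<open>In elements: \<open>((hk)\<^sub>1\<cdot>1) \<otimes> (hk)\<^sub>2 = u\<^sub>2(h\<^sub>1,k\<^sub>1) \<otimes> h\<^sub>2k\<^sub>2\<close>, by multiplicativity of the coproduct.\<close>

lemma j_mult: "j \<cdot> \<mu>\<^bsub>H\<^esub> = (u \<otimes> \<mu>\<^bsub>H\<^esub>) \<cdot> \<delta>\<delta>"
  by (simp add: j_def comult_mult merges[THEN Comp_rewrite] u_eq)

text \<open>In elements: \<open>h\<^sub>1\<cdot>(k\<^sub>1\<cdot>1) \<otimes> h\<^sub>2 \<otimes> k\<^sub>2 = u\<^sub>2(h\<^sub>1,k\<^sub>1) \<otimes> h\<^sub>2 \<otimes> k\<^sub>2\<close>, since the action is associative on the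
unit.\<close>

lemma psi_h_j: "(\<psi> \<otimes> \<langle>h\<rangle>) \<cdot> (\<langle>h\<rangle> \<otimes> j) = (u \<otimes> \<langle>h\<rangle> \<otimes> \<langle>h\<rangle>) \<cdot> \<delta>\<delta>"
proof -
  have s: "\<c> h a \<cdot> (\<langle>h\<rangle> \<otimes> v) = (v \<otimes> \<langle>h\<rangle>) \<cdot> \<c> h h"
    using Sym_slide[of "\<langle>h\<rangle>" v] by simp
  have d: "(\<delta>\<^bsub>H\<^esub> \<otimes> \<langle>a\<rangle>) \<cdot> (\<langle>h\<rangle> \<otimes> v)
      = (\<langle>h\<rangle> \<otimes> \<langle>h\<rangle> \<otimes> v) \<cdot> (\<delta>\<^bsub>H\<^esub> \<otimes> \<langle>h\<rangle>)"
    by (simp add: parallel)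
  have "\<psi> \<cdot> (\<langle>h\<rangle> \<otimes> v)
      = (\<phi> \<otimes> \<langle>h\<rangle>) \<cdot> (\<langle>h\<rangle> \<otimes> (\<c> h a \<cdot> (\<langle>h\<rangle> \<otimes> v))) \<cdot> (\<delta>\<^bsub>H\<^esub> \<otimes> \<langle>h\<rangle>)"
    by (simp add: psi_def layers d)
  also have "\<dots> = ((\<phi> \<cdot> (\<langle>h\<rangle> \<otimes> v)) \<otimes> \<langle>h\<rangle>) \<cdot> (\<langle>h\<rangle> \<otimes> \<c> h h) \<cdot> (\<delta>\<^bsub>H\<^esub> \<otimes> \<langle>h\<rangle>)"
    unfolding s by (simp add: layers)
  also have "\<phi> \<cdot> (\<langle>h\<rangle> \<otimes> v) = u"
    by (simp add: u1_def u2_def action_action_unit)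
  finally have "\<psi> \<cdot> (\<langle>h\<rangle> \<otimes> v) = (u \<otimes> \<langle>h\<rangle>) \<cdot> (\<langle>h\<rangle> \<otimes> \<c> h h) \<cdot> (\<delta>\<^bsub>H\<^esub> \<otimes> \<langle>h\<rangle>)" .
  then have "((\<psi> \<cdot> (\<langle>h\<rangle> \<otimes> v)) \<otimes> \<langle>h\<rangle>) \<cdot> (\<langle>h\<rangle> \<otimes> \<delta>\<^bsub>H\<^esub>)
      = (((u \<otimes> \<langle>h\<rangle>) \<cdot> (\<langle>h\<rangle> \<otimes> \<c> h h) \<cdot> (\<delta>\<^bsub>H\<^esub> \<otimes> \<langle>h\<rangle>)) \<otimes> \<langle>h\<rangle>) \<cdot> (\<langle>h\<rangle> \<otimes> \<delta>\<^bsub>H\<^esub>)"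
    by simp
  moreover have "(\<delta>\<^bsub>H\<^esub> \<otimes> \<langle>h\<rangle> \<otimes> \<langle>h\<rangle>) \<cdot> (\<langle>h\<rangle> \<otimes> \<delta>\<^bsub>H\<^esub>)
      = \<delta>\<^bsub>H\<^esub> \<otimes> \<delta>\<^bsub>H\<^esub>"
    by (simp add: parallel)
  ultimately show ?thesis
    by (simp add: j_def comult2_def tensor_comult_def layers)
qed

section \<open>The product of the weak crossed product absorbs the idempotent\<close>

context
  fixes \<alpha>
  assumes \<alpha>: "\<alpha> \<in> Reg_plus C H A \<phi>"
begin

text \<open>The map \<open>\<sigma>(h \<otimes> k) = \<alpha>(h\<^sub>1,k\<^sub>1) \<otimes> h\<^sub>2k\<^sub>2\<close> and \<open>\<psi>\<close> determine the product \<open>m\<close>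
on \<open>A \<otimes> H\<close>.\<close>

abbreviation \<sigma> where "\<sigma> \<equiv> sigma_of C H \<alpha>"
abbreviation m where "m \<equiv> cross_mult C H A \<phi> \<alpha>"

lemma alpha_hom: "\<alpha> \<in> hom C (h \<odot> h) a"
  using \<alpha> by (auto simp: Reg_plus_def Reg_def)

lemmas alpha_typing [simp] = alpha_hom[THEN homD(1)] alpha_hom[THEN homD(2)] alpha_hom[THEN homD(3)]

text \<open>Regularity makes \<open>u\<^sub>2\<close> neutral for \<open>\<alpha>\<close> on both sides; the right side needs
\<open>\<alpha> \<and> (\<alpha>\<^sup>-\<^sup>1 \<and> \<alpha>) = (\<alpha> \<and> \<alpha>\<^sup>-\<^sup>1) \<and> \<alpha>\<close>.\<close>

lemma alpha_u: "u \<star> \<alpha> = \<alpha>" "\<alpha> \<star> u = \<alpha>"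
proof -
  obtain \<tau> where "\<tau> \<in> hom C (h \<odot> h) a" "\<alpha> \<star> \<tau> = u" "\<tau> \<star> \<alpha> = u" "\<alpha> \<star> \<tau> \<star> \<alpha> = \<alpha>"
    using \<alpha> by (auto simp: Reg_plus_def Reg_def)
  then show "u \<star> \<alpha> = \<alpha>" "\<alpha> \<star> u = \<alpha>"
    using conv_assoc[of \<alpha> \<tau> \<alpha>] alpha_hom by simp_all
qed

lemma sigma_typing [simp]: "\<sigma> \<in> Arr C" "Dom C \<sigma> = h \<odot> h" "Cod C \<sigma> = a \<odot> h"
  by (simp_all add: sigma_of_def)

lemma m_typing [simp]: "m \<in> Arr C" "Dom C m = a \<odot> h \<odot> a \<odot> h" "Cod C m = a \<odot> h"
  by (simp_all add: cross_mult_def)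

text \<open>In elements: \<open>\<alpha>(h\<^sub>1,k\<^sub>1) (h\<^sub>2k\<^sub>2\<cdot>1) \<otimes> h\<^sub>3k\<^sub>3 = \<alpha>(h\<^sub>1,k\<^sub>1) \<otimes> h\<^sub>2k\<^sub>2\<close>, which is \<open>\<alpha> \<and> u\<^sub>2 = \<alpha>\<close>.\<close>

lemma nabla_sigma: "N \<cdot> \<sigma> = \<sigma>"
proof -
  have "N \<cdot> \<sigma> = (\<mu>\<^bsub>A\<^esub> \<otimes> \<langle>h\<rangle>) \<cdot> (\<alpha> \<otimes> (j \<cdot> \<mu>\<^bsub>H\<^esub>)) \<cdot> \<delta>\<delta>"
    by (simp add: nabla_eq sigma_of_def) (simp add: parallel)
  also have "\<dots> = \<sigma>"
    unfolding j_mult by (simp add: conv_mult homI alpha_u sigma_of_def)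
  finally show ?thesis .
qed

text \<open>The map \<open>h \<otimes> b \<otimes> k \<mapsto> (h\<^sub>1\<cdot>b) \<alpha>(h\<^sub>2,k\<^sub>1) \<otimes> h\<^sub>3k\<^sub>2\<close>, the product of \<open>1 \<otimes> h\<close> with \<open>b \<otimes> k\<close>; the full
product is its \<open>A\<close>-linear extension (\<open>m_eq\<close>).\<close>

definition \<chi> where "\<chi> = (\<mu>\<^bsub>A\<^esub> \<otimes> \<langle>h\<rangle>) \<cdot> (\<langle>a\<rangle> \<otimes> \<sigma>) \<cdot> (\<psi> \<otimes> \<langle>h\<rangle>)"

lemma chi_typing [simp]: "\<chi> \<in> Arr C" "Dom C \<chi> = h \<odot> a \<odot> h" "Cod C \<chi> = a \<odot> h"
  by (simp_all add: \<chi>_def)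

text \<open>In elements: \<open>(h\<^sub>1\<cdot>(k\<^sub>1\<cdot>1)) \<alpha>(h\<^sub>2,k\<^sub>2) \<otimes> h\<^sub>3k\<^sub>3 = \<alpha>(h\<^sub>1,k\<^sub>1) \<otimes> h\<^sub>2k\<^sub>2\<close>, which is \<open>u\<^sub>2 \<and> \<alpha> = \<alpha>\<close>.\<close>

lemma chi_j: "\<chi> \<cdot> (\<langle>h\<rangle> \<otimes> j) = \<sigma>"
proof -
  have "\<chi> \<cdot> (\<langle>h\<rangle> \<otimes> j)
      = (\<mu>\<^bsub>A\<^esub> \<otimes> \<langle>h\<rangle>) \<cdot> (\<langle>a\<rangle> \<otimes> \<sigma>) \<cdot> (u \<otimes> \<langle>h\<rangle> \<otimes> \<langle>h\<rangle>) \<cdot> \<delta>\<delta>"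
    by (simp add: \<chi>_def psi_h_j)
  also have "\<dots> = (\<mu>\<^bsub>A\<^esub> \<otimes> \<langle>h\<rangle>) \<cdot> (u \<otimes> \<sigma>) \<cdot> \<delta>\<delta>"
    by (simp add: parallel)
  also have "\<dots> = \<sigma>"
    by (simp add: sigma_of_def conv_mult homI alpha_u)
  finally show ?thesis .
qed

text \<open>In elements: \<open>\<chi>(h \<otimes> bc \<otimes> k) = (h\<^sub>1\<cdot>b) \<chi>(h\<^sub>2 \<otimes> c \<otimes> k)\<close>.\<close>

lemma chi_mult: "\<chi> \<cdot> (\<langle>h\<rangle> \<otimes> \<mu>\<^bsub>A\<^esub> \<otimes> \<langle>h\<rangle>) = (\<mu>\<^bsub>A\<^esub> \<otimes> \<langle>h\<rangle>) \<cdot> (\<langle>a\<rangle> \<otimes> \<chi>) \<cdot> (\<psi> \<otimes> \<langle>a\<rangle> \<otimes> \<langle>h\<rangle>)"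
proof -
  have "\<chi> \<cdot> (\<langle>h\<rangle> \<otimes> \<mu>\<^bsub>A\<^esub> \<otimes> \<langle>h\<rangle>)
      = (\<mu>\<^bsub>A\<^esub> \<otimes> \<langle>h\<rangle>) \<cdot> (\<langle>a\<rangle> \<otimes> \<sigma>) \<cdot> ((\<psi> \<cdot> (\<langle>h\<rangle> \<otimes> \<mu>\<^bsub>A\<^esub>)) \<otimes> \<langle>h\<rangle>)"
    by (simp add: \<chi>_def layers)
  also have "\<dots> = (\<mu>\<^bsub>A\<^esub> \<otimes> \<langle>h\<rangle>) \<cdot> ((\<langle>a\<rangle> \<otimes> \<sigma>) \<cdot> (\<mu>\<^bsub>A\<^esub> \<otimes> \<langle>h\<rangle> \<otimes> \<langle>h\<rangle>)) \<cdot> (\<langle>a\<rangle> \<otimes> \<psi> \<otimes> \<langle>h\<rangle>) \<cdot> (\<psi> \<otimes> \<langle>a\<rangle> \<otimes> \<langle>h\<rangle>)"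
    unfolding psi_mult by (simp add: layers)
  also have "(\<langle>a\<rangle> \<otimes> \<sigma>) \<cdot> (\<mu>\<^bsub>A\<^esub> \<otimes> \<langle>h\<rangle> \<otimes> \<langle>h\<rangle>)
      = (\<mu>\<^bsub>A\<^esub> \<otimes> \<langle>a\<rangle> \<otimes> \<langle>h\<rangle>) \<cdot> (\<langle>a\<rangle> \<otimes> \<langle>a\<rangle> \<otimes> \<sigma>)"
    by (simp add: parallel)
  also have "(\<mu>\<^bsub>A\<^esub> \<otimes> \<langle>h\<rangle>) \<cdot> ((\<mu>\<^bsub>A\<^esub> \<otimes> \<langle>a\<rangle> \<otimes> \<langle>h\<rangle>) \<cdot> (\<langle>a\<rangle> \<otimes> \<langle>a\<rangle> \<otimes> \<sigma>)) \<cdot> (\<langle>a\<rangle> \<otimes> \<psi> \<otimes> \<langle>h\<rangle>) \<cdot> (\<psi> \<otimes> \<langle>a\<rangle> \<otimes> \<langle>h\<rangle>)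
    = ((\<mu>\<^bsub>A\<^esub> \<cdot> (\<mu>\<^bsub>A\<^esub> \<otimes> \<langle>a\<rangle>)) \<otimes> \<langle>h\<rangle>) \<cdot> (\<langle>a\<rangle> \<otimes> \<langle>a\<rangle> \<otimes> \<sigma>) \<cdot> (\<langle>a\<rangle> \<otimes> \<psi> \<otimes> \<langle>h\<rangle>) \<cdot> (\<psi> \<otimes> \<langle>a\<rangle> \<otimes> \<langle>h\<rangle>)"
    by (simp add: layers)
  also have "\<dots> = (\<mu>\<^bsub>A\<^esub> \<otimes> \<langle>h\<rangle>) \<cdot> (\<langle>a\<rangle> \<otimes> \<chi>) \<cdot> (\<psi> \<otimes> \<langle>a\<rangle> \<otimes> \<langle>h\<rangle>)"
    unfolding mult_assoc by (simp add: \<chi>_def layers)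
  finally show ?thesis .
qed

lemma m_eq: "m = (\<mu>\<^bsub>A\<^esub> \<otimes> \<langle>h\<rangle>) \<cdot> (\<langle>a\<rangle> \<otimes> \<chi>)"
proof -
  have s: "\<mu>\<^bsub>A\<^esub> \<otimes> \<sigma>
      = (\<mu>\<^bsub>A\<^esub> \<otimes> \<langle>a\<rangle> \<otimes> \<langle>h\<rangle>) \<cdot> (\<langle>a\<rangle> \<otimes> \<langle>a\<rangle> \<otimes> \<sigma>)"
    by (simp add: parallel)
  have "m = ((\<mu>\<^bsub>A\<^esub> \<cdot> (\<mu>\<^bsub>A\<^esub> \<otimes> \<langle>a\<rangle>)) \<otimes> \<langle>h\<rangle>) \<cdot> (\<langle>a\<rangle> \<otimes> \<langle>a\<rangle> \<otimes> \<sigma>) \<cdot> (\<langle>a\<rangle> \<otimes> \<psi> \<otimes> \<langle>h\<rangle>)"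
    by (simp add: cross_mult_def layers s)
  also have "\<dots> = (\<mu>\<^bsub>A\<^esub> \<otimes> \<langle>h\<rangle>) \<cdot> (\<langle>a\<rangle> \<otimes> \<chi>)"
    unfolding mult_assoc by (simp add: \<chi>_def layers)
  finally show ?thesis .
qed

lemma nabla_chi: "N \<cdot> \<chi> = \<chi>"
  by (simp add: \<chi>_def nabla_module[THEN Comp_rewrite] merges[THEN Comp_rewrite] nabla_sigma)

text \<open>In elements: \<open>(h\<^sub>1\<cdot>1) \<chi>(h\<^sub>2 \<otimes> b \<otimes> k) = \<chi>(h \<otimes> b \<otimes> k)\<close>, the case of \<open>chi_mult\<close> with first factor \<open>1\<close>.\<close>

lemma chi_unit_left: "(\<mu>\<^bsub>A\<^esub> \<otimes> \<langle>h\<rangle>) \<cdot> (\<langle>a\<rangle> \<otimes> \<chi>) \<cdot> (j \<otimes> \<langle>a\<rangle> \<otimes> \<langle>h\<rangle>) = \<chi>"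
proof -
  have "(\<mu>\<^bsub>A\<^esub> \<otimes> \<langle>h\<rangle>) \<cdot> (\<langle>a\<rangle> \<otimes> \<chi>) \<cdot> (j \<otimes> \<langle>a\<rangle> \<otimes> \<langle>h\<rangle>)
    = \<chi> \<cdot> (\<langle>h\<rangle> \<otimes> (\<mu>\<^bsub>A\<^esub> \<cdot> (\<eta>\<^bsub>A\<^esub> \<otimes> \<langle>a\<rangle>)) \<otimes> \<langle>h\<rangle>)"
    by (simp add: layers chi_mult[THEN Comp_rewrite] psi_unit[symmetric])
  then show ?thesis unfolding mult_unit_left by simp
qed

lemma chi_nabla: "\<chi> \<cdot> (\<langle>h\<rangle> \<otimes> N) = \<chi>"
proof -
  have "\<chi> \<cdot> (\<langle>h\<rangle> \<otimes> N)
      = (\<mu>\<^bsub>A\<^esub> \<otimes> \<langle>h\<rangle>) \<cdot> (\<langle>a\<rangle> \<otimes> \<chi>) \<cdot> (\<psi> \<otimes> \<langle>a\<rangle> \<otimes> \<langle>h\<rangle>) \<cdot> (\<langle>h\<rangle> \<otimes> \<langle>a\<rangle> \<otimes> j)"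
    by (simp add: nabla_eq layers chi_mult[THEN Comp_rewrite])
  also have "(\<psi> \<otimes> \<langle>a\<rangle> \<otimes> \<langle>h\<rangle>) \<cdot> (\<langle>h\<rangle> \<otimes> \<langle>a\<rangle> \<otimes> j)
      = (\<langle>a\<rangle> \<otimes> \<langle>h\<rangle> \<otimes> j) \<cdot> (\<psi> \<otimes> \<langle>h\<rangle>)"
    by (simp add: parallel)
  also have "(\<mu>\<^bsub>A\<^esub> \<otimes> \<langle>h\<rangle>) \<cdot> (\<langle>a\<rangle> \<otimes> \<chi>) \<cdot> (\<langle>a\<rangle> \<otimes> \<langle>h\<rangle> \<otimes> j) \<cdot> (\<psi> \<otimes> \<langle>h\<rangle>)
      = \<chi>"
    by (simp add: merges[THEN Comp_rewrite] chi_j) (simp add: \<chi>_def)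
  finally show ?thesis .
qed

lemma nabla_m: "N \<cdot> m = m"
  by (simp add: m_eq nabla_module[THEN Comp_rewrite] merge nabla_chi)

lemma m_nabla: "m \<cdot> (N \<otimes> N) = m"
proof -
  have s: "N \<otimes> N = (\<langle>a\<rangle> \<otimes> \<langle>h\<rangle> \<otimes> N) \<cdot> (N \<otimes> \<langle>a\<rangle> \<otimes> \<langle>h\<rangle>)"
    by (simp add: merges)
  have "m \<cdot> (N \<otimes> N)
      = (\<mu>\<^bsub>A\<^esub> \<otimes> \<langle>h\<rangle>) \<cdot> (\<langle>a\<rangle> \<otimes> (\<chi> \<cdot> (\<langle>h\<rangle> \<otimes> N))) \<cdot> (N \<otimes> \<langle>a\<rangle> \<otimes> \<langle>h\<rangle>)"
    by (simp add: m_eq layers s)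
  also have "\<dots> = (\<mu>\<^bsub>A\<^esub> \<otimes> \<langle>h\<rangle>) \<cdot> ((\<langle>a\<rangle> \<otimes> \<chi>) \<cdot> (\<mu>\<^bsub>A\<^esub> \<otimes> \<langle>h\<rangle> \<otimes> \<langle>a\<rangle> \<otimes> \<langle>h\<rangle>)) \<cdot> (\<langle>a\<rangle> \<otimes> j \<otimes> \<langle>a\<rangle> \<otimes> \<langle>h\<rangle>)"
    unfolding chi_nabla by (simp add: nabla_eq layers)
  also have "(\<langle>a\<rangle> \<otimes> \<chi>) \<cdot> (\<mu>\<^bsub>A\<^esub> \<otimes> \<langle>h\<rangle> \<otimes> \<langle>a\<rangle> \<otimes> \<langle>h\<rangle>)
      = (\<mu>\<^bsub>A\<^esub> \<otimes> \<langle>a\<rangle> \<otimes> \<langle>h\<rangle>) \<cdot> (\<langle>a\<rangle> \<otimes> \<langle>a\<rangle> \<otimes> \<chi>)"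
    by (simp add: parallel)
  also have "(\<mu>\<^bsub>A\<^esub> \<otimes> \<langle>h\<rangle>) \<cdot> ((\<mu>\<^bsub>A\<^esub> \<otimes> \<langle>a\<rangle> \<otimes> \<langle>h\<rangle>) \<cdot> (\<langle>a\<rangle> \<otimes> \<langle>a\<rangle> \<otimes> \<chi>)) \<cdot> (\<langle>a\<rangle> \<otimes> j \<otimes> \<langle>a\<rangle> \<otimes> \<langle>h\<rangle>)
     = ((\<mu>\<^bsub>A\<^esub> \<cdot> (\<mu>\<^bsub>A\<^esub> \<otimes> \<langle>a\<rangle>)) \<otimes> \<langle>h\<rangle>) \<cdot> (\<langle>a\<rangle> \<otimes> \<langle>a\<rangle> \<otimes> \<chi>) \<cdot> (\<langle>a\<rangle> \<otimes> j \<otimes> \<langle>a\<rangle> \<otimes> \<langle>h\<rangle>)"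
    by (simp add: layers)
  also have "\<dots> = (\<mu>\<^bsub>A\<^esub> \<otimes> \<langle>h\<rangle>) \<cdot> (\<langle>a\<rangle> \<otimes> ((\<mu>\<^bsub>A\<^esub> \<otimes> \<langle>h\<rangle>) \<cdot> (\<langle>a\<rangle> \<otimes> \<chi>) \<cdot> (j \<otimes> \<langle>a\<rangle> \<otimes> \<langle>h\<rangle>)))"
    unfolding mult_assoc by (simp add: layers)
  also have "\<dots> = m"
    unfolding chi_unit_left m_eq ..
  finally show ?thesis .
qed

end

section \<open>Transport along the splitting\<close>

context
  fixes P p i
  assumes split: "splitting C (a \<odot> h) N P p i"
begin

abbreviation act where "act \<equiv> assoc_action C H A p i"
abbreviation coact where "coact \<equiv> assoc_coaction C H A p i"
text \<open>The product that \<open>A \<times> H\<close> inherits from \<open>A \<otimes>\<^sub>\<alpha> H\<close>.\<close>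

abbreviation mP where "mP \<alpha> \<equiv> p \<cdot> cross_mult C H A \<phi> \<alpha> \<cdot> (i \<otimes> i)"

lemma split_hom: "p \<in> hom C (a \<odot> h) P" "i \<in> hom C P (a \<odot> h)"
  using split by (auto simp: splitting_def)

lemmas split_typing [simp] = split_hom[THEN homD(1)] split_hom[THEN homD(2)] split_hom[THEN homD(3)]
  split_hom(1)[THEN homD(5)]

lemma split_Comp: "i \<cdot> p = N" "p \<cdot> i = \<langle>P\<rangle>"
  using split by (auto simp: splitting_def)

lemma nabla_i: "N \<cdot> i = i"
  using split_Comp by (simp flip: split_Comp(1))

lemma p_nabla: "p \<cdot> N = p"
  by (simp add: split_Comp(2)[THEN Comp_rewrite] flip: split_Comp(1))

lemma structure_homs:
  "\<mu>\<^bsub>A\<^esub> \<otimes> \<langle>h\<rangle> \<in> hom C (a \<odot> a \<odot> h) (a \<odot> h)" "\<langle>a\<rangle> \<otimes> \<delta>\<^bsub>H\<^esub> \<in> hom C (a \<odot> h) ((a \<odot> h) \<odot> h)"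
  "act \<in> hom C (a \<odot> P) P" "coact \<in> hom C P (P \<odot> h)"
  by (simp_all add: homI assoc_action_def assoc_coaction_def)

lemma p_module: "left_module_morphism C A (a \<odot> h) (\<mu>\<^bsub>A\<^esub> \<otimes> \<langle>h\<rangle>) P act p"
proof -
  have "act \<cdot> (\<langle>a\<rangle> \<otimes> p) = p \<cdot> (\<mu>\<^bsub>A\<^esub> \<otimes> \<langle>h\<rangle>) \<cdot> (\<langle>a\<rangle> \<otimes> N)"
    by (simp add: assoc_action_def merge split_Comp)
  also have "\<dots> = (p \<cdot> N) \<cdot> (\<mu>\<^bsub>A\<^esub> \<otimes> \<langle>h\<rangle>)"
    unfolding nabla_module[symmetric] by simp
  finally show ?thesis
    using split_hom by (simp add: left_module_morphism_def p_nabla)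
qed

lemma i_module: "left_module_morphism C A P act (a \<odot> h) (\<mu>\<^bsub>A\<^esub> \<otimes> \<langle>h\<rangle>) i"
proof -
  have "i \<cdot> act = (i \<cdot> p) \<cdot> (\<mu>\<^bsub>A\<^esub> \<otimes> \<langle>h\<rangle>) \<cdot> (\<langle>a\<rangle> \<otimes> i)"
    by (simp add: assoc_action_def)
  also have "\<dots> = (\<mu>\<^bsub>A\<^esub> \<otimes> \<langle>h\<rangle>) \<cdot> (\<langle>a\<rangle> \<otimes> (N \<cdot> i))"
    unfolding split_Comp by (simp add: nabla_module[THEN Comp_rewrite] layers)
  finally show ?thesis
    using split_hom by (simp add: left_module_morphism_def nabla_i)
qed

lemma p_comodule: "right_comodule_morphism C H (a \<odot> h) (\<langle>a\<rangle> \<otimes> \<delta>\<^bsub>H\<^esub>) P coact p"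
proof -
  have "coact \<cdot> p = (p \<otimes> \<langle>h\<rangle>) \<cdot> (\<langle>a\<rangle> \<otimes> \<delta>\<^bsub>H\<^esub>) \<cdot> N"
    by (simp add: assoc_coaction_def split_Comp)
  also have "\<dots> = ((p \<cdot> N) \<otimes> \<langle>h\<rangle>) \<cdot> (\<langle>a\<rangle> \<otimes> \<delta>\<^bsub>H\<^esub>)"
    unfolding nabla_comodule by (simp add: layers)
  finally show ?thesis
    using split_hom by (simp add: right_comodule_morphism_def p_nabla)
qed

lemma i_comodule: "right_comodule_morphism C H P coact (a \<odot> h) (\<langle>a\<rangle> \<otimes> \<delta>\<^bsub>H\<^esub>) i"
proof -
  have "(i \<otimes> \<langle>h\<rangle>) \<cdot> coact = ((i \<cdot> p) \<otimes> \<langle>h\<rangle>) \<cdot> (\<langle>a\<rangle> \<otimes> \<delta>\<^bsub>H\<^esub>) \<cdot> i"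
    by (simp add: assoc_coaction_def layers)
  also have "\<dots> = (\<langle>a\<rangle> \<otimes> \<delta>\<^bsub>H\<^esub>) \<cdot> N \<cdot> i"
    unfolding split_Comp by (simp add: nabla_comodule[THEN Comp_rewrite])
  finally show ?thesis
    using split_hom by (simp add: right_comodule_morphism_def nabla_i)
qed

lemma mult_homs:
  assumes "\<alpha> \<in> Reg_plus C H A \<phi>"
  shows "cross_mult C H A \<phi> \<alpha> \<in> hom C ((a \<odot> h) \<odot> (a \<odot> h)) (a \<odot> h)" "mP \<alpha> \<in> hom C (P \<odot> P) P"
  using assms by (simp_all add: homI)

lemma p_mult:
  assumes "\<alpha> \<in> Reg_plus C H A \<phi>"
  shows "multiplicative C (cross_mult C H A \<phi> \<alpha>) (mP \<alpha>) p"
  using assms by (simp add: multiplicative_def merge split_Comp m_nabla)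

lemma i_mult:
  assumes "\<alpha> \<in> Reg_plus C H A \<phi>"
  shows "multiplicative C (mP \<alpha>) (cross_mult C H A \<phi> \<alpha>) i"
  using assms by (simp add: multiplicative_def split_Comp(1)[THEN Comp_rewrite] nabla_m[THEN Comp_rewrite])

lemma unit_typing [simp]: "preunit C H A \<phi> \<in> Arr C" "Dom C (preunit C H A \<phi>) = Unit C" "Cod C (preunit C H A \<phi>) = a \<odot> h"
  by (simp_all add: preunit_def)

lemma nabla_unit: "N \<cdot> preunit C H A \<phi> = preunit C H A \<phi>"
proof -
  have "N \<cdot> N = i \<cdot> (p \<cdot> N)"
    by (simp flip: split_Comp(1))
  then have "N \<cdot> N = N" by (simp add: p_nabla split_Comp)
  then show ?thesis by (simp add: preunit_def Comp_rewrite)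
qed

text \<open>The conditions on the isomorphism in an equivalence of crossed products, invertibility excepted.\<close>

abbreviation is_equiv where
  "is_equiv \<alpha> \<beta> f \<equiv> algebra_morphism C (assoc_algebra C H A \<phi> P p i \<alpha>) (assoc_algebra C H A \<phi> P p i \<beta>) f \<and>
      left_module_morphism C A P act P act f \<and> right_comodule_morphism C H P coact P coact f"

text \<open>The conditions imposed separately on each of the two endomorphisms \<open>\<Gamma>\<close>, \<open>\<Gamma>'\<close> of \<open>A \<otimes> H\<close>.\<close>

abbreviation is_gauge where
  "is_gauge \<alpha> \<beta> \<Gamma> \<equiv> module_comodule_endo C H A \<Gamma> \<and>
     multiplicative C (cross_mult C H A \<phi> \<alpha>) (cross_mult C H A \<phi> \<beta>) \<Gamma> \<and>
     \<Gamma> \<cdot> preunit C H A \<phi> = preunit C H A \<phi>"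

lemma gauge_of_equiv:
  assumes r: "\<alpha> \<in> Reg_plus C H A \<phi>" "\<beta> \<in> Reg_plus C H A \<phi>" and f: "is_equiv \<alpha> \<beta> f"
  shows "is_gauge \<alpha> \<beta> (i \<cdot> f \<cdot> p)"
proof -
  have fh: "f \<in> hom C P P" and fm: "multiplicative C (mP \<alpha>) (mP \<beta>) f"
    and fu: "f \<cdot> p \<cdot> preunit C H A \<phi> = p \<cdot> preunit C H A \<phi>"
    using f by (auto simp: algebra_morphism_def assoc_algebra_def)
  note [simp] = fh[THEN homD(1)] fh[THEN homD(2)] fh[THEN homD(3)]
  have h: "f \<cdot> p \<in> hom C (a \<odot> h) P" "f \<in> hom C P P"
    using fh by (auto intro!: homI)
  have "left_module_morphism C A (a \<odot> h) (\<mu>\<^bsub>A\<^esub> \<otimes> \<langle>h\<rangle>) (a \<odot> h) (\<mu>\<^bsub>A\<^esub> \<otimes> \<langle>h\<rangle>) (i \<cdot> f \<cdot> p)"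
    using f p_module i_module structure_homs by (blast intro: left_module_morphism_comp objs)
  moreover have "right_comodule_morphism C H (a \<odot> h) (\<langle>a\<rangle> \<otimes> \<delta>\<^bsub>H\<^esub>) (a \<odot> h) (\<langle>a\<rangle> \<otimes> \<delta>\<^bsub>H\<^esub>) (i \<cdot> f \<cdot> p)"
    using f p_comodule i_comodule structure_homs by (blast intro: right_comodule_morphism_comp objs)
  moreover have "multiplicative C (cross_mult C H A \<phi> \<alpha>) (cross_mult C H A \<phi> \<beta>) (i \<cdot> f \<cdot> p)"
    using multiplicative_comp[OF multiplicative_comp[OF p_mult[OF r(1)] fm] i_mult[OF r(2)]]
      mult_homs r split_hom h by blast
  moreover have "(i \<cdot> f \<cdot> p) \<cdot> preunit C H A \<phi> = preunit C H A \<phi>"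
    by (simp add: fu split_Comp(1)[THEN Comp_rewrite] nabla_unit)
  ultimately show ?thesis
    by (simp add: module_comodule_endo_def)
qed

lemma equiv_of_gauge:
  assumes r: "\<alpha> \<in> Reg_plus C H A \<phi>" "\<beta> \<in> Reg_plus C H A \<phi>" and g: "is_gauge \<alpha> \<beta> \<Gamma>"
  shows "is_equiv \<alpha> \<beta> (p \<cdot> \<Gamma> \<cdot> i)"
proof -
  have h: "\<Gamma> \<in> hom C (a \<odot> h) (a \<odot> h)"
    using g by (auto simp: module_comodule_endo_def left_module_morphism_def)
  note [simp] = h[THEN homD(1)] h[THEN homD(2)] h[THEN homD(3)]
  have h': "\<Gamma> \<cdot> i \<in> hom C P (a \<odot> h)" "p \<cdot> \<Gamma> \<cdot> i \<in> hom C P P"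
    by (auto intro!: homI)
  have "left_module_morphism C A P act P act (p \<cdot> \<Gamma> \<cdot> i)"
    using g p_module i_module structure_homs
    unfolding module_comodule_endo_def by (blast intro: left_module_morphism_comp objs)
  moreover have "right_comodule_morphism C H P coact P coact (p \<cdot> \<Gamma> \<cdot> i)"
    using g p_comodule i_comodule structure_homs
    unfolding module_comodule_endo_def by (blast intro: right_comodule_morphism_comp objs)
  moreover have "multiplicative C (mP \<alpha>) (mP \<beta>) (p \<cdot> \<Gamma> \<cdot> i)"
    using multiplicative_comp[OF multiplicative_comp[OF i_mult[OF r(1)]] p_mult[OF r(2)]]
      mult_homs r split_hom h h' g by blast
  moreover have "(p \<cdot> \<Gamma> \<cdot> i) \<cdot> p \<cdot> preunit C H A \<phi> = p \<cdot> preunit C H A \<phi>"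
    using g by (simp add: split_Comp(1)[THEN Comp_rewrite] nabla_unit)
  ultimately show ?thesis
    using h' by (simp add: algebra_morphism_def assoc_algebra_def)
qed

lemma equiv_inverse:
  assumes r: "\<alpha> \<in> Reg_plus C H A \<phi>" "\<beta> \<in> Reg_plus C H A \<phi>" and f: "is_equiv \<alpha> \<beta> f"
    and g: "g \<in> hom C P P" "g \<cdot> f = \<langle>P\<rangle>" "f \<cdot> g = \<langle>P\<rangle>"
  shows "is_equiv \<beta> \<alpha> g"
proof -
  have fh: "f \<in> hom C P P" and fm: "multiplicative C (mP \<alpha>) (mP \<beta>) f"
    and fu: "f \<cdot> p \<cdot> preunit C H A \<phi> = p \<cdot> preunit C H A \<phi>"
    using f by (auto simp: algebra_morphism_def assoc_algebra_def)
  note [simp] = fh[THEN homD(1)] fh[THEN homD(2)] fh[THEN homD(3)]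
    g(1)[THEN homD(1)] g(1)[THEN homD(2)] g(1)[THEN homD(3)]
  have "g \<cdot> p \<cdot> preunit C H A \<phi> = g \<cdot> f \<cdot> p \<cdot> preunit C H A \<phi>"
    unfolding fu ..
  also have "\<dots> = p \<cdot> preunit C H A \<phi>"
    by (simp add: g(2)[THEN Comp_rewrite])
  finally have "g \<cdot> p \<cdot> preunit C H A \<phi> = p \<cdot> preunit C H A \<phi>" .
  moreover have "multiplicative C (mP \<beta>) (mP \<alpha>) g"
    using multiplicative_inverse[OF fm fh g] mult_homs r by blast
  moreover have "left_module_morphism C A P act P act g"
    using f g structure_homs by (blast intro: left_module_morphism_inverse objs)
  moreover have "right_comodule_morphism C H P coact P coact g"
    using f g structure_homs by (blast intro: right_comodule_morphism_inverse objs)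
  ultimately show ?thesis
    using g(1) by (simp add: algebra_morphism_def assoc_algebra_def)
qed

lemma equivalent_iff:
  assumes r: "\<alpha> \<in> Reg_plus C H A \<phi>" "\<beta> \<in> Reg_plus C H A \<phi>"
  shows "crossed_products_equivalent C H A \<phi> P p i \<alpha> \<beta> \<longleftrightarrow>
    (\<exists>\<Gamma> \<Gamma>'. is_gauge \<alpha> \<beta> \<Gamma> \<and> is_gauge \<beta> \<alpha> \<Gamma>' \<and>
       \<Gamma> \<cdot> \<Gamma>' = N \<and> \<Gamma>' \<cdot> \<Gamma> = N \<and> \<Gamma> \<cdot> \<Gamma>' \<cdot> \<Gamma> = \<Gamma> \<and> \<Gamma>' \<cdot> \<Gamma> \<cdot> \<Gamma>' = \<Gamma>')" (is "?L \<longleftrightarrow> ?R")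
proof
  assume ?L
  then obtain f where iso: "isomorphism C P P f" and f: "is_equiv \<alpha> \<beta> f"
    by (auto simp: crossed_products_equivalent_def)
  then obtain g where fh: "f \<in> hom C P P" and g: "g \<in> hom C P P" "g \<cdot> f = \<langle>P\<rangle>" "f \<cdot> g = \<langle>P\<rangle>"
    by (auto simp: isomorphism_def)
  note [simp] = fh[THEN homD(1)] fh[THEN homD(2)] fh[THEN homD(3)]
    g(1)[THEN homD(1)] g(1)[THEN homD(2)] g(1)[THEN homD(3)]
    split_Comp g(2,3) split_Comp[THEN Comp_rewrite] g(2,3)[THEN Comp_rewrite] p_nabla
  have "is_gauge \<alpha> \<beta> (i \<cdot> f \<cdot> p)" "is_gauge \<beta> \<alpha> (i \<cdot> g \<cdot> p)"
    using gauge_of_equiv[OF r f] gauge_of_equiv[OF r(2,1) equiv_inverse[OF r f g]] .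
  moreover have "(i \<cdot> f \<cdot> p) \<cdot> (i \<cdot> g \<cdot> p) = N" "(i \<cdot> g \<cdot> p) \<cdot> (i \<cdot> f \<cdot> p) = N"
    "(i \<cdot> f \<cdot> p) \<cdot> (i \<cdot> g \<cdot> p) \<cdot> (i \<cdot> f \<cdot> p) = i \<cdot> f \<cdot> p"
    "(i \<cdot> g \<cdot> p) \<cdot> (i \<cdot> f \<cdot> p) \<cdot> (i \<cdot> g \<cdot> p) = i \<cdot> g \<cdot> p"
    by simp_all
  ultimately show ?R by blast
next
  assume ?R
  then obtain \<Gamma> \<Gamma>' where gauge: "is_gauge \<alpha> \<beta> \<Gamma>" "is_gauge \<beta> \<alpha> \<Gamma>'"
    and inv: "\<Gamma> \<cdot> \<Gamma>' = N" "\<Gamma>' \<cdot> \<Gamma> = N" "\<Gamma> \<cdot> \<Gamma>' \<cdot> \<Gamma> = \<Gamma>" "\<Gamma>' \<cdot> \<Gamma> \<cdot> \<Gamma>' = \<Gamma>'"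
    by blast
  then have h: "\<Gamma> \<in> hom C (a \<odot> h) (a \<odot> h)" "\<Gamma>' \<in> hom C (a \<odot> h) (a \<odot> h)"
    by (auto simp: module_comodule_endo_def left_module_morphism_def)
  note [simp] = h[THEN homD(1)] h[THEN homD(2)] h[THEN homD(3)]
  \<comment> \<open>The identities \<open>\<Gamma> \<cdot> \<Gamma>' \<cdot> \<Gamma> = \<Gamma>\<close> and \<open>\<Gamma>' \<cdot> \<Gamma> \<cdot> \<Gamma>' = \<Gamma>'\<close> are used only through this absorption.\<close>
  have eqs: "\<Gamma> \<cdot> N = \<Gamma>" "\<Gamma>' \<cdot> N = \<Gamma>'"
    using inv by simp_all
  have "(p \<cdot> \<Gamma>' \<cdot> i) \<cdot> (p \<cdot> \<Gamma> \<cdot> i) = p \<cdot> ((\<Gamma>' \<cdot> N) \<cdot> \<Gamma>) \<cdot> i"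
    by (simp add: split_Comp(1)[THEN Comp_rewrite])
  also have "\<dots> = \<langle>P\<rangle>"
    unfolding eqs inv by (simp add: nabla_i split_Comp)
  finally have 1: "(p \<cdot> \<Gamma>' \<cdot> i) \<cdot> (p \<cdot> \<Gamma> \<cdot> i) = \<langle>P\<rangle>" .
  have "(p \<cdot> \<Gamma> \<cdot> i) \<cdot> (p \<cdot> \<Gamma>' \<cdot> i) = p \<cdot> ((\<Gamma> \<cdot> N) \<cdot> \<Gamma>') \<cdot> i"
    by (simp add: split_Comp(1)[THEN Comp_rewrite])
  also have "\<dots> = \<langle>P\<rangle>"
    unfolding eqs inv by (simp add: nabla_i split_Comp)
  finally have "isomorphism C P P (p \<cdot> \<Gamma> \<cdot> i)"
    unfolding isomorphism_def using 1 by (auto intro!: homI bexI[of _ "p \<cdot> \<Gamma>' \<cdot> i"])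
  with equiv_of_gauge[OF r gauge(1)] show ?L
    unfolding crossed_products_equivalent_def by blast
qed

end
end

theorem theorem3p5:
  fixes C :: "('o, 'm) smcat" (structure)
    and H :: "('o, 'm) alg_coalg" and A :: "('o, 'm) alg"
    and \<phi> \<alpha> \<beta> p i :: 'm and AxH :: 'o
  assumes "strict_symmetric_monoidal_category_with_equalizers C"
    and "weak_Hopf_algebra C H" and "cocommutative C H"
    and "weak_left_module_algebra C H A \<phi>"
    and "\<alpha> \<in> Reg_plus C H A \<phi>" and "twisted C H A \<phi> \<alpha>" and "two_cocycle C H A \<phi> \<alpha>"
    and "\<beta> \<in> Reg_plus C H A \<phi>" and "twisted C H A \<phi> \<beta>" and "two_cocycle C H A \<phi> \<beta>"
    and "splitting C (ob A \<odot> ob H) (nabla C H A \<phi>) AxH p i"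
  shows "crossed_products_equivalent C H A \<phi> AxH p i \<alpha> \<beta> \<longleftrightarrow>
    (\<exists>\<Gamma> \<Gamma>'.
       module_comodule_endo C H A \<Gamma> \<and> module_comodule_endo C H A \<Gamma>' \<and>
       multiplicative C (cross_mult C H A \<phi> \<alpha>) (cross_mult C H A \<phi> \<beta>) \<Gamma> \<and>
       multiplicative C (cross_mult C H A \<phi> \<beta>) (cross_mult C H A \<phi> \<alpha>) \<Gamma>' \<and>
       \<Gamma> \<cdot> preunit C H A \<phi> = preunit C H A \<phi> \<and>
       \<Gamma>' \<cdot> preunit C H A \<phi> = preunit C H A \<phi> \<and>
       \<Gamma> \<cdot> \<Gamma>' = nabla C H A \<phi> \<and> \<Gamma>' \<cdot> \<Gamma> = nabla C H A \<phi> \<and>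
       \<Gamma> \<cdot> \<Gamma>' \<cdot> \<Gamma> = \<Gamma> \<and>
       \<Gamma>' \<cdot> \<Gamma> \<cdot> \<Gamma>' = \<Gamma>')"
proof -
  interpret strict_symmetric_monoidal_category_with_equalizers C by fact
  interpret crossed_product_data C H A \<phi>
    using assms(2,4) by unfold_locales
  show ?thesis
    unfolding equivalent_iff[OF assms(11,5,8)] by blast
qed

end
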